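(* Let $\mathscr G=\{\mathsf H_1,\dots,\mathsf H_{n_0}\}$, $n_0\ge1$, be a finite collection of Hénon maps and let $\{h_k\}_{k\ge1}\subset\mathscr G$ be a sequence. With $h(k)=h_k\circ\cdots\circ h_1$, $h^{-1}(k)=h_k^{-1}\circ\cdots\circ h_1^{-1}$ and $\mathbf d_k=\deg h_1\cdots\deg h_k$, put $$\mathsf G_k^+(z)=\frac1{\mathbf d_k}\log^+\|h(k)(z)\|,\qquad\mathsf G_k^-(z)=\frac1{\mathbf d_k}\log^+\|h^{-1}(k)(z)\|.$$ Then the sequences $\{\mathsf G_k^+\}$ and $\{\mathsf G_k^-\}$ converge pointwise on $\mathbb C^2$ to plurisubharmonic continuous functions $\mathsf G_{\{h_k\}}^+$ and $\mathsf G_{\{h_k\}}^-$, respectively. Further, $\mathsf G_{\{h_k\}}^\pm$ is pluriharmonic on $\mathbf U_{\{h_k\}}^\pm$ and on the interior of $\mathbf K_{\{h_k\}}^\pm$ (respectively).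
   Context: A Hénon map here means a polynomial automorphism of $\mathbb C^2$ of the form $H_1\circ\cdots\circ H_m$, $m\ge1$, where each $H_j(x,y)=(y,p_j(y)-a_jx)$ with $a_j\ne0$ and $p_j$ a polynomial of degree at least $2$; its degree is its degree as a polynomial map. $\|\cdot\|$ is the supremum norm on $\mathbb C^2$ and $\log^+x=\max\{\log x,0\}$. The escaping and bounded sets are $\mathbf U^+_{\{h_k\}}=\{z: h(k)(z)\to\infty\text{ as }k\to\infty\}$, $\mathbf U^-_{\{h_k\}}=\{z: h^{-1}(k)(z)\to\infty\text{ as }k\to\infty\}$, $\mathbf K^+_{\{h_k\}}=\{z:\{h(k)(z)\}_k\text{ is bounded}\}$, $\mathbf K^-_{\{h_k\}}=\{z:\{h^{-1}(k)(z)\}_k\text{ is bounded}\}$. *)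

theory Defs
  imports "HOL-Analysis.Analysis" "HOL-Computational_Algebra.Polynomial"
begin

section \<open>Polynomial maps of \<open>\<complex>\<^sup>2\<close> and Henon maps\<close>

definition poly_fun_deg_le :: "nat \<Rightarrow> (complex \<times> complex \<Rightarrow> complex) \<Rightarrow> bool" where
  "poly_fun_deg_le n f \<longleftrightarrow>
     (\<exists>c :: nat \<Rightarrow> nat \<Rightarrow> complex. \<forall>x y. f (x, y) = (\<Sum>i\<le>n. \<Sum>j\<le>n - i. c i j * x ^ i * y ^ j))"

text \<open>The maximum of the total degrees of the two components. The value is meaningful only for
  polynomial maps, since \<open>LEAST\<close> is unspecified if no bound exists.\<close>

definition poly_map_degree :: "(complex \<times> complex \<Rightarrow> complex \<times> complex) \<Rightarrow> nat" where
  "poly_map_degree F =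
     (LEAST n. poly_fun_deg_le n (\<lambda>z. fst (F z)) \<and> poly_fun_deg_le n (\<lambda>z. snd (F z)))"

definition elementary_henon :: "complex \<Rightarrow> complex poly \<Rightarrow> complex \<times> complex \<Rightarrow> complex \<times> complex" where
  "elementary_henon a p = (\<lambda>(x, y). (y, poly p y - a * x))"

inductive henon_map :: "(complex \<times> complex \<Rightarrow> complex \<times> complex) \<Rightarrow> bool" where
  elementary: "a \<noteq> 0 \<Longrightarrow> degree p \<ge> 2 \<Longrightarrow> henon_map (elementary_henon a p)"
| compose: "a \<noteq> 0 \<Longrightarrow> degree p \<ge> 2 \<Longrightarrow> henon_map F \<Longrightarrow> henon_map (elementary_henon a p \<circ> F)"


section \<open>Non-autonomous iteration\<close>

text \<open>\<open>comp_seq f k = f k \<circ> \<dots> \<circ> f 1\<close>; the entry \<open>f 0\<close> is never used. For the backward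
  iterates the order is the same, \<open>(h k)\<^sup>-\<^sup>1 \<circ> \<dots> \<circ> (h 1)\<^sup>-\<^sup>1\<close>, so that \<open>comp_seq\<close> of the inverses is in
  general not the inverse of \<open>comp_seq h k\<close>.\<close>

primrec comp_seq :: "(nat \<Rightarrow> 'a \<Rightarrow> 'a) \<Rightarrow> nat \<Rightarrow> 'a \<Rightarrow> 'a" where
  "comp_seq f 0 = id"
| "comp_seq f (Suc k) = f (Suc k) \<circ> comp_seq f k"

abbreviation forward_iter ::
    "(nat \<Rightarrow> complex \<times> complex \<Rightarrow> complex \<times> complex) \<Rightarrow> nat \<Rightarrow> complex \<times> complex \<Rightarrow> complex \<times> complex" where
  "forward_iter h \<equiv> comp_seq h"

abbreviation backward_iter ::
    "(nat \<Rightarrow> complex \<times> complex \<Rightarrow> complex \<times> complex) \<Rightarrow> nat \<Rightarrow> complex \<times> complex \<Rightarrow> complex \<times> complex" where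
  "backward_iter h \<equiv> comp_seq (\<lambda>k. inv (h k))"

definition escaping_set :: "(nat \<Rightarrow> complex \<times> complex \<Rightarrow> complex \<times> complex) \<Rightarrow> (complex \<times> complex) set" where
  "escaping_set \<phi> = {z. filterlim (\<lambda>k. \<phi> k z) at_infinity sequentially}"

definition bounded_set :: "(nat \<Rightarrow> complex \<times> complex \<Rightarrow> complex \<times> complex) \<Rightarrow> (complex \<times> complex) set" where
  "bounded_set \<phi> = {z. bounded ((\<lambda>k. \<phi> k z) ` {1..})}"

definition U_plus where "U_plus h = escaping_set (forward_iter h)"
definition U_minus where "U_minus h = escaping_set (backward_iter h)"
definition K_plus where "K_plus h = bounded_set (forward_iter h)"
definition K_minus where "K_minus h = bounded_set (backward_iter h)"

text \<open>The norm of the product type is the Euclidean one, hence a separate supremum norm.\<close>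

definition sup_norm :: "complex \<times> complex \<Rightarrow> real" where
  "sup_norm z = max (cmod (fst z)) (cmod (snd z))"

text \<open>Since \<open>ln 0 = 0\<close> for real numbers, this gives the usual value \<open>log_plus 0 = 0\<close>.\<close>

definition log_plus :: "real \<Rightarrow> real" where
  "log_plus t = max (ln t) 0"

definition deg_prod :: "(nat \<Rightarrow> complex \<times> complex \<Rightarrow> complex \<times> complex) \<Rightarrow> nat \<Rightarrow> nat" where
  "deg_prod h k = (\<Prod>j=1..k. poly_map_degree (h j))"

definition G_plus ::
    "(nat \<Rightarrow> complex \<times> complex \<Rightarrow> complex \<times> complex) \<Rightarrow> nat \<Rightarrow> complex \<times> complex \<Rightarrow> real" where
  "G_plus h k z = 1 / real (deg_prod h k) * log_plus (sup_norm (forward_iter h k z))"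

definition G_minus ::
    "(nat \<Rightarrow> complex \<times> complex \<Rightarrow> complex \<times> complex) \<Rightarrow> nat \<Rightarrow> complex \<times> complex \<Rightarrow> real" where
  "G_minus h k z = 1 / real (deg_prod h k) * log_plus (sup_norm (backward_iter h k z))"


section \<open>Plurisubharmonic and pluriharmonic functions on open subsets of \<open>\<complex>\<^sup>2\<close>\<close>

definition complex_line :: "complex \<times> complex \<Rightarrow> complex \<times> complex \<Rightarrow> complex \<Rightarrow> complex \<times> complex" where
  "complex_line a b \<zeta> = (fst a + \<zeta> * fst b, snd a + \<zeta> * snd b)"

text \<open>The Lebesgue integral of an extended real valued function as the difference of the integrals
  of its positive and negative parts (\<open>e2ennreal\<close> maps negative numbers to \<open>0\<close>). It is
  meaningful if at most one of the two is infinite; below the positive part is bounded.\<close>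

definition ereal_integral :: "'a measure \<Rightarrow> ('a \<Rightarrow> ereal) \<Rightarrow> ereal" where
  "ereal_integral M f =
     enn2ereal (\<integral>\<^sup>+ x. e2ennreal (f x) \<partial>M) - enn2ereal (\<integral>\<^sup>+ x. e2ennreal (- f x) \<partial>M)"

definition circle_mean :: "(complex \<Rightarrow> ereal) \<Rightarrow> ereal" where
  "circle_mean v = ereal_integral (uniform_measure lborel {0..2 * pi}) (\<lambda>t. v (cis t))"

text \<open>Upper semicontinuous with values in \<open>[-\<infinity>, \<infinity>)\<close>, not identically \<open>-\<infinity>\<close> on any
  component, and satisfying the sub-mean value inequality on every closed disc of every complex
  line contained in \<open>\<Omega>\<close>; the radius of the disc is absorbed in \<open>b\<close>.\<close>

definition plurisubharmonic_on :: "(complex \<times> complex) set \<Rightarrow> (complex \<times> complex \<Rightarrow> ereal) \<Rightarrow> bool" where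
  "plurisubharmonic_on \<Omega> u \<longleftrightarrow>
     open \<Omega> \<and>
     (\<forall>z\<in>\<Omega>. u z < \<infinity>) \<and>
     (\<forall>c. open {z\<in>\<Omega>. u z < c}) \<and>
     (\<forall>C\<in>components \<Omega>. \<exists>z\<in>C. u z \<noteq> -\<infinity>) \<and>
     (\<forall>a b. complex_line a b ` cball 0 1 \<subseteq> \<Omega> \<longrightarrow>
        u a \<le> circle_mean (\<lambda>\<zeta>. u (complex_line a b \<zeta>)))"

definition has_C2_derivs_on ::
    "('a::real_normed_vector \<Rightarrow> real) \<Rightarrow> ('a \<Rightarrow> 'a \<Rightarrow>\<^sub>L real) \<Rightarrow> ('a \<Rightarrow> 'a \<Rightarrow>\<^sub>L 'a \<Rightarrow>\<^sub>L real) \<Rightarrow> 'a set \<Rightarrow> bool" where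
  "has_C2_derivs_on f D D2 S \<longleftrightarrow>
     (\<forall>x\<in>S. (f has_derivative blinfun_apply (D x)) (at x)) \<and>
     (\<forall>x\<in>S. (D has_derivative blinfun_apply (D2 x)) (at x)) \<and>
     continuous_on S D2"

text \<open>Twice continuously differentiable with vanishing Laplacian; \<open>D2 \<zeta> 1 1\<close> and
  \<open>D2 \<zeta> \<i> \<i>\<close> are the pure second partial derivatives in the real and imaginary directions.\<close>

definition harmonic_on :: "complex set \<Rightarrow> (complex \<Rightarrow> real) \<Rightarrow> bool" where
  "harmonic_on S v \<longleftrightarrow>
     open S \<and> (\<exists>D D2. has_C2_derivs_on v D D2 S \<and>
       (\<forall>\<zeta>\<in>S. blinfun_apply (blinfun_apply (D2 \<zeta>) 1) 1 + blinfun_apply (blinfun_apply (D2 \<zeta>) \<i>) \<i> = 0))"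

definition pluriharmonic_on :: "(complex \<times> complex) set \<Rightarrow> (complex \<times> complex \<Rightarrow> real) \<Rightarrow> bool" where
  "pluriharmonic_on \<Omega> u \<longleftrightarrow>
     open \<Omega> \<and> (\<exists>D D2. has_C2_derivs_on u D D2 \<Omega>) \<and>
     (\<forall>a b. harmonic_on {\<zeta>. complex_line a b \<zeta> \<in> \<Omega>} (\<lambda>\<zeta>. u (complex_line a b \<zeta>)))"

end

theory Submission
  imports Defs "HOL-Complex_Analysis.Complex_Analysis"
    "HOL-Computational_Algebra.Fundamental_Theorem_Algebra"
begin

text \<open>A Henon map \<open>H\<close> of degree \<open>d\<close> satisfies \<open>snd (H z) / snd z ^ d \<longlonglongrightarrow> c \<noteq> 0\<close> as \<open>snd z \<longlonglongrightarrow> \<infinity>\<close> in the cone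
  \<open>|x| \<le> |y|\<close>. For large \<open>R\<close> it maps \<open>|x| \<le> max R |y|\<close> into itself, changing \<open>log_plus\<close> of the norm there
  from \<open>t\<close> to \<open>d t + O(1)\<close>, while a point whose image is outside has at least twice the norm of the image. Hence
  an orbit starting in a ball enters this region after a uniformly bounded time, and the functions \<open>G\<^sub>k\<close> form a
  uniform Cauchy sequence on the ball. The sub-mean value property passes to the limit; for \<open>G\<^sub>k\<close> it
  is Jensen's inequality for polynomials in one variable. Near an escaping point the limit is the
  real part of \<open>Ln y\<^sub>K / d\<^sub>K + \<Sum> (Ln (y\<^sub>k\<^sub>+\<^sub>1 / (c y\<^sub>k ^ d)) + ln |c|) / d\<^sub>k\<^sub>+\<^sub>1\<close>, a uniformly convergent series of
  holomorphic functions. The backward statement is the forward one for the maps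
  \<open>swap \<circ> inv (h k) \<circ> swap\<close>, which are Henon maps of the same degree.\<close>

text \<open>Two sources of uniformity drive the convergence. Finiteness of the collection gives one
  \<open>R\<close> and one \<open>M\<close> for all maps, and degrees at least 2 give d_k >= 2^k, so
  an error bounded by \<open>M\<close> in the k-th step changes the normalised logarithm by at most
  M / 2^k. The obstacle is the region |x| > max R |y|: there p(y) and a x may cancel, so no estimate
  d t + O(1) is available. An orbit can stay there only while its norm is at least halved in each
  step, which bounds its stay in terms of the starting norm. In the logarithmic series every
  quotient lies within 1/2 of 1, so the principal branch serves all terms, and only the initial
  coordinate y_K needs a local choice of branch. Since \<open>pluriharmonic_on\<close> asks for one
  pair of derivative fields on the whole set, the local representations have to be glued. On
  \<open>K_plus\<close> the limit is 0, because a bounded numerator is divided by d_k. The backward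
  iterates apply the inverse of \<open>h 1\<close> first; after exchanging coordinates they are
  forward iterates of another sequence from a finite collection.\<close>

section \<open>Holomorphic functions of two variables and pluriharmonicity\<close>

text \<open>Holomorphy in two variables, in the form of continuity together with holomorphy on complex
  lines. Closure under uniform limits and directional derivatives is then a one-variable statement.\<close>

definition line_holo :: "(complex \<times> complex) set \<Rightarrow> (complex \<times> complex \<Rightarrow> complex) \<Rightarrow> bool" where
  "line_holo \<Omega> f \<longleftrightarrow> continuous_on \<Omega> f \<and>
     (\<forall>a b. (\<lambda>\<zeta>. f (complex_line a b \<zeta>)) holomorphic_on {\<zeta>. complex_line a b \<zeta> \<in> \<Omega>})"

lemma line_holoD:
  assumes "line_holo \<Omega> f"
  shows "continuous_on \<Omega> f"
    and "(\<lambda>\<zeta>. f (complex_line a b \<zeta>)) holomorphic_on {\<zeta>. complex_line a b \<zeta> \<in> \<Omega>}"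
  using assms unfolding line_holo_def by blast+

lemma continuous_on_complex_line [continuous_intros]:
  assumes "continuous_on S f" "continuous_on S g" "continuous_on S k"
  shows "continuous_on S (\<lambda>x. complex_line (f x) (g x) (k x))"
  unfolding complex_line_def by (intro continuous_intros assms)

lemma complex_line_0 [simp]: "complex_line a b 0 = a"
  by (simp add: complex_line_def)

lemma complex_line_add: "complex_line a b (s + t) = complex_line (complex_line a b s) b t"
  by (simp add: complex_line_def algebra_simps)

lemma complex_line_commute:
  "complex_line (complex_line a b s) c t = complex_line (complex_line a c t) b s"
  by (simp add: complex_line_def algebra_simps)

lemma open_complex_line_vimage:
  assumes "open \<Omega>" shows "open {\<zeta>. complex_line a b \<zeta> \<in> \<Omega>}"
proof -
  have "continuous_on UNIV (complex_line a b)"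
    by (intro continuous_intros)
  then have "open (complex_line a b -` \<Omega>)"
    using assms open_vimage by blast
  then show ?thesis by (simp add: vimage_def)
qed

lemma line_holo_subset:
  assumes "line_holo \<Omega> f" "S \<subseteq> \<Omega>" shows "line_holo S f"
  unfolding line_holo_def
proof (intro conjI allI)
  show "continuous_on S f"
    using line_holoD(1)[OF assms(1)] assms(2) by (rule continuous_on_subset)
  show "(\<lambda>\<zeta>. f (complex_line a b \<zeta>)) holomorphic_on {\<zeta>. complex_line a b \<zeta> \<in> S}" for a b
    by (rule holomorphic_on_subset[OF line_holoD(2)[OF assms(1)]]) (use assms(2) in blast)
qed

lemma line_holo_const: "line_holo \<Omega> (\<lambda>_. c)"
  by (simp add: line_holo_def)

lemma line_holo_add: "line_holo \<Omega> f \<Longrightarrow> line_holo \<Omega> g \<Longrightarrow> line_holo \<Omega> (\<lambda>z. f z + g z)"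
  by (simp add: line_holo_def continuous_on_add holomorphic_on_add)

lemma line_holo_mult: "line_holo \<Omega> f \<Longrightarrow> line_holo \<Omega> g \<Longrightarrow> line_holo \<Omega> (\<lambda>z. f z * g z)"
  by (simp add: line_holo_def continuous_on_mult holomorphic_on_mult)

lemma line_holo_compose:
  assumes "line_holo \<Omega> f" "g holomorphic_on T" "\<And>z. z \<in> \<Omega> \<Longrightarrow> f z \<in> T"
  shows "line_holo \<Omega> (\<lambda>z. g (f z))"
proof -
  have "continuous_on \<Omega> (\<lambda>z. g (f z))"
    using assms continuous_on_compose2[OF holomorphic_on_imp_continuous_on[OF assms(2)], of \<Omega> f]
    by (simp add: line_holo_def image_subset_iff)
  moreover have "(\<lambda>\<zeta>. g (f (complex_line a b \<zeta>))) holomorphic_on {\<zeta>. complex_line a b \<zeta> \<in> \<Omega>}" for a b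
    using holomorphic_on_compose_gen[OF line_holoD(2)[OF assms(1)] assms(2), of a b] assms(3)
    unfolding o_def by blast
  ultimately show ?thesis by (simp add: line_holo_def)
qed

lemma line_holo_sum:
  assumes "\<And>i. i \<in> I \<Longrightarrow> line_holo \<Omega> (f i)"
  shows "line_holo \<Omega> (\<lambda>z. \<Sum>i\<in>I. f i z)"
  using assms by (simp add: line_holo_def continuous_on_sum holomorphic_on_sum)

text \<open>Weierstrass' theorem on each complex line; joint continuity is preserved by uniform
  convergence.\<close>

lemma line_holo_uniform_limit:
  fixes f :: "nat \<Rightarrow> complex \<times> complex \<Rightarrow> complex"
  assumes "open \<Omega>" and f: "\<And>n. line_holo \<Omega> (f n)"
    and ul: "uniform_limit \<Omega> f g sequentially"
  shows "line_holo \<Omega> g"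
  unfolding line_holo_def
proof (intro conjI allI)
  show "continuous_on \<Omega> g"
    using f ul by (intro uniform_limit_theorem[OF _ ul]) (auto simp: line_holo_def)
next
  fix a b
  let ?S = "{\<zeta>. complex_line a b \<zeta> \<in> \<Omega>}"
  show "(\<lambda>\<zeta>. g (complex_line a b \<zeta>)) holomorphic_on ?S"
  proof (rule holomorphic_uniform_sequence[where f = "\<lambda>n \<zeta>. f n (complex_line a b \<zeta>)"])
    show "open ?S" by (rule open_complex_line_vimage[OF \<open>open \<Omega>\<close>])
    show "(\<lambda>\<zeta>. f n (complex_line a b \<zeta>)) holomorphic_on ?S" for n
      by (rule line_holoD(2)[OF f])
    fix x assume "x \<in> ?S"
    then obtain d where d: "d > 0" "cball x d \<subseteq> ?S"
      using \<open>open ?S\<close> open_contains_cball by blast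
    have "uniform_limit (cball x d) (\<lambda>n \<zeta>. f n (complex_line a b \<zeta>)) (\<lambda>\<zeta>. g (complex_line a b \<zeta>)) sequentially"
      by (rule uniform_limit_compose'[OF ul]) (use d in auto)
    with d show "\<exists>d>0. cball x d \<subseteq> ?S \<and>
        uniform_limit (cball x d) (\<lambda>n \<zeta>. f n (complex_line a b \<zeta>)) (\<lambda>\<zeta>. g (complex_line a b \<zeta>)) sequentially"
      by blast
  qed
qed

section \<open>Directional complex derivatives through the Cauchy integral\<close>

definition line_deriv :: "complex \<times> complex \<Rightarrow> (complex \<times> complex \<Rightarrow> complex) \<Rightarrow> complex \<times> complex \<Rightarrow> complex" where
  "line_deriv b F z = deriv (\<lambda>\<zeta>. F (complex_line z b \<zeta>)) 0"

text \<open>Moving the base point along the line only translates the parameter, so the derivative at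
  any parameter is the derivative at 0 on the re-based line.\<close>

lemma has_field_derivative_line_deriv:
  assumes "line_holo \<Omega> F" "open \<Omega>" "complex_line a b \<zeta> \<in> \<Omega>"
  shows "((\<lambda>t. F (complex_line a b t)) has_field_derivative line_deriv b F (complex_line a b \<zeta>)) (at \<zeta>)"
proof -
  have *: "((\<lambda>t. F (complex_line a b t)) has_field_derivative deriv (\<lambda>t. F (complex_line a b t)) \<zeta>) (at \<zeta>)"
    using assms open_complex_line_vimage[of \<Omega> a b]
    by (intro holomorphic_derivI[of _ "{\<zeta>. complex_line a b \<zeta> \<in> \<Omega>}"])
       (simp_all only: line_holo_def mem_Collect_eq)
  have "((\<lambda>t. F (complex_line a b (\<zeta> + t))) has_field_derivative deriv (\<lambda>t. F (complex_line a b t)) \<zeta>) (at 0)"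
    using DERIV_shift[of "\<lambda>t. F (complex_line a b t)" "deriv (\<lambda>t. F (complex_line a b t)) \<zeta>" 0 \<zeta>] *
    by (simp only: add_0_right add.commute[of _ \<zeta>])
  then have "line_deriv b F (complex_line a b \<zeta>) = deriv (\<lambda>t. F (complex_line a b t)) \<zeta>"
    unfolding line_deriv_def by (simp add: complex_line_add DERIV_imp_deriv)
  with * show ?thesis by metis
qed

text \<open>Cauchy's formula replaces differentiation by integration over a circle. The base point
  then enters only through the integrand, so continuity and holomorphy in \<open>z\<close> can be
  taken under the integral sign.\<close>

lemma line_deriv_integral:
  assumes F: "line_holo \<Omega> F" and "r > 0" and sub: "complex_line z b ` cball 0 r \<subseteq> \<Omega>"
  shows "line_deriv b F z =
     integral {0..2*pi} (\<lambda>t. F (complex_line z b (of_real r * cis t)) / (2 * pi * of_real r * cis t))"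
proof -
  let ?f = "\<lambda>\<zeta>. F (complex_line z b \<zeta>)"
  have hol: "?f holomorphic_on cball 0 r"
    by (rule holomorphic_on_subset[OF line_holoD(2)[OF F]]) (use sub in blast)
  have "((\<lambda>u. ?f u / (u - 0) ^ Suc 1) has_contour_integral (2 * pi * \<i>) / fact 1 * (deriv ^^ 1) ?f 0) (circlepath 0 r)"
    by (rule Cauchy_has_contour_integral_higher_derivative_circlepath
          [OF holomorphic_on_imp_continuous_on[OF hol] holomorphic_on_subset[OF hol ball_subset_cball]])
       (use \<open>r > 0\<close> in simp)
  then have "((\<lambda>u. ?f u / u\<^sup>2) has_contour_integral (2 * pi * \<i>) * line_deriv b F z) (circlepath 0 r)"
    by (simp add: line_deriv_def power2_eq_square)
  then have "((\<lambda>t. ?f (r * cis t) / (r * cis t)\<^sup>2 * r * \<i> * cis t) has_integral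
      (2 * pi * \<i>) * line_deriv b F z) {0..2*pi}"
    unfolding circlepath_def by (subst (asm) has_contour_integral_part_circlepath_iff) auto
  then have "((\<lambda>t. (1 / (2 * pi * \<i>)) * (?f (r * cis t) / (r * cis t)\<^sup>2 * r * \<i> * cis t)) has_integral
      (1 / (2 * pi * \<i>)) * ((2 * pi * \<i>) * line_deriv b F z)) {0..2*pi}"
    by (rule has_integral_mult_right)
  moreover have "(1 / (2 * pi * \<i>)) * (?f (r * cis t) / (r * cis t)\<^sup>2 * r * \<i> * cis t) =
      ?f (r * cis t) / (2 * pi * r * cis t)" for t
    using \<open>r > 0\<close> by (simp add: field_simps power2_eq_square)
  ultimately show ?thesis
    by (simp add: integral_unique)
qed

text \<open>One radius serves all base points near \<open>z\<close>, so the contour in the Cauchy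
  integral need not vary with the point.\<close>

lemma complex_line_uniform_radius:
  assumes "open \<Omega>" "z \<in> \<Omega>"
  obtains r U where "r > 0" "open U" "z \<in> U" "U \<subseteq> \<Omega>" "\<And>w. w \<in> U \<Longrightarrow> complex_line w b ` cball 0 r \<subseteq> \<Omega>"
proof -
  have "continuous_on UNIV (\<lambda>p. complex_line (fst p) b (snd p))"
    by (intro continuous_intros)
  then have "open ((\<lambda>p. complex_line (fst p) b (snd p)) -` \<Omega>)"
    using assms open_vimage by blast
  moreover have "(z, 0) \<in> ((\<lambda>p. complex_line (fst p) b (snd p)) -` \<Omega>)"
    using assms by simp
  ultimately obtain U V where UV: "open U" "open V" "(z, 0) \<in> U \<times> V"
    "U \<times> V \<subseteq> (\<lambda>p. complex_line (fst p) b (snd p)) -` \<Omega>"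
    by (rule open_prod_elim)
  then obtain r where r: "r > 0" "cball 0 r \<subseteq> V"
    using open_contains_cball[of V] by blast
  show ?thesis
  proof (rule that[of r "U \<inter> \<Omega>"])
    show "complex_line w b ` cball 0 r \<subseteq> \<Omega>" if "w \<in> U \<inter> \<Omega>" for w
      using UV(4) r that by fastforce
  qed (use UV r assms in auto)
qed

lemma continuous_on_line_deriv:
  assumes F: "line_holo \<Omega> F" and "open \<Omega>"
  shows "continuous_on \<Omega> (line_deriv b F)"
proof (rule continuous_at_imp_continuous_on, rule ballI)
  fix z assume "z \<in> \<Omega>"
  obtain r U where rU: "r > 0" "open U" "z \<in> U" "U \<subseteq> \<Omega>" "\<And>w. w \<in> U \<Longrightarrow> complex_line w b ` cball 0 r \<subseteq> \<Omega>"
    using complex_line_uniform_radius[OF \<open>open \<Omega>\<close> \<open>z \<in> \<Omega>\<close>] by blast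
  have "continuous_on (U \<times> {0..2*pi}) (\<lambda>p. F (complex_line (fst p) b (of_real r * cis (snd p))))"
  proof (rule continuous_on_compose2[of \<Omega> F])
    show "(\<lambda>p. complex_line (fst p) b (of_real r * cis (snd p))) ` (U \<times> {0..2*pi}) \<subseteq> \<Omega>"
    proof (rule image_subsetI)
      fix p assume "p \<in> U \<times> {0..2*pi}"
      moreover have "of_real r * cis (snd p) \<in> cball 0 r" using \<open>r > 0\<close> by (simp add: norm_mult)
      ultimately show "complex_line (fst p) b (of_real r * cis (snd p)) \<in> \<Omega>"
        by (intro subsetD[OF rU(5)[of "fst p"]] imageI) auto
    qed
  qed (intro line_holoD(1)[OF F] continuous_intros)+
  then have "continuous_on (U \<times> cbox 0 (2*pi))
      (\<lambda>(w, t). F (complex_line w b (of_real r * cis t)) / (2 * pi * of_real r * cis t))"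
    unfolding case_prod_unfold using \<open>r > 0\<close> by (auto intro!: continuous_intros)
  from integral_continuous_on_param[OF this]
  have "continuous_on U (line_deriv b F)"
    by (rule continuous_on_eq) (simp add: line_deriv_integral[OF F \<open>r > 0\<close> rU(5)])
  then show "isCont (line_deriv b F) z"
    using rU(2,3) continuous_on_eq_continuous_at by blast
qed

text \<open>Differentiation under the Cauchy integral for direction \<open>b\<close>: along
  direction \<open>c\<close> the integrand has derivative \<open>line_deriv c F\<close>, because
  translations in the two directions commute. Repeated use gives the second partial
  derivatives.\<close>

lemma line_holo_line_deriv:
  assumes F: "line_holo \<Omega> F" and "open \<Omega>"
  shows "line_holo \<Omega> (line_deriv b F)"
  unfolding line_holo_def
proof (intro conjI allI continuous_on_line_deriv[OF assms])
  fix a c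
  let ?S = "{\<zeta>. complex_line a c \<zeta> \<in> \<Omega>}"
  have "(\<lambda>\<zeta>. line_deriv b F (complex_line a c \<zeta>)) field_differentiable (at \<zeta>)" if "\<zeta> \<in> ?S" for \<zeta>
  proof -
    obtain r U where rU: "r > 0" "open U" "complex_line a c \<zeta> \<in> U" "U \<subseteq> \<Omega>"
        "\<And>w. w \<in> U \<Longrightarrow> complex_line w b ` cball 0 r \<subseteq> \<Omega>"
      using complex_line_uniform_radius[OF \<open>open \<Omega>\<close>, of "complex_line a c \<zeta>"] \<open>\<zeta> \<in> ?S\<close> by blast
    obtain e where e: "e > 0" "ball \<zeta> e \<subseteq> {\<zeta>. complex_line a c \<zeta> \<in> U}"
      using openE[OF open_complex_line_vimage[OF rU(2), of a c], of \<zeta>] rU(3) by blast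
    have in_\<Omega>: "complex_line (complex_line a c x) b (of_real r * cis t) \<in> \<Omega>" if "x \<in> ball \<zeta> e" for x t
      by (rule subsetD[OF rU(5)]) (use e that \<open>r > 0\<close> in \<open>auto simp: norm_mult\<close>)
    let ?g = "\<lambda>x t. F (complex_line (complex_line a c x) b (of_real r * cis t)) / (2 * pi * of_real r * cis t)"
    let ?g' = "\<lambda>x t. line_deriv c F (complex_line (complex_line a c x) b (of_real r * cis t)) / (2 * pi * of_real r * cis t)"
    have "(\<lambda>x. integral (cbox 0 (2*pi)) (?g x)) holomorphic_on ball \<zeta> e"
    proof (rule leibniz_rule_holomorphic[where fx = ?g'])
      fix x and t :: real assume x: "x \<in> ball \<zeta> e"
      show "((\<lambda>x. ?g x t) has_field_derivative ?g' x t) (at x within ball \<zeta> e)"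
      proof (rule has_field_derivative_at_within, rule DERIV_cdivide)
        show "((\<lambda>x. F (complex_line (complex_line a c x) b (of_real r * cis t))) has_field_derivative
            line_deriv c F (complex_line (complex_line a c x) b (of_real r * cis t))) (at x)"
          unfolding complex_line_commute[of a c _ b]
          by (rule has_field_derivative_line_deriv[OF F \<open>open \<Omega>\<close>])
             (use in_\<Omega>[OF x] in \<open>simp add: complex_line_commute\<close>)
      qed
    next
      fix x assume x: "x \<in> ball \<zeta> e"
      have "continuous_on {0..2*pi} (\<lambda>t. F (complex_line (complex_line a c x) b (of_real r * cis t)))"
        by (rule continuous_on_compose2[of \<Omega> F])
           (use F in_\<Omega>[OF x] in \<open>auto simp: line_holo_def intro!: continuous_intros\<close>)
      then show "?g x integrable_on cbox 0 (2*pi)"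
        using \<open>r > 0\<close> by (intro integrable_continuous continuous_intros) auto
    next
      have "continuous_on (ball \<zeta> e \<times> {0..2*pi})
          (\<lambda>p. line_deriv c F (complex_line (complex_line a c (fst p)) b (of_real r * cis (snd p))))"
        by (rule continuous_on_compose2[OF continuous_on_line_deriv[OF assms, of c]])
           (use in_\<Omega> in \<open>auto intro!: continuous_intros\<close>)
      then show "continuous_on (ball \<zeta> e \<times> cbox 0 (2*pi)) (\<lambda>(x, t). ?g' x t)"
        unfolding case_prod_unfold using \<open>r > 0\<close> by (auto intro!: continuous_intros)
    qed auto
    moreover have "integral (cbox 0 (2*pi)) (?g x) = line_deriv b F (complex_line a c x)" if "x \<in> ball \<zeta> e" for x
    proof -
      have "complex_line a c x \<in> U" using that e by blast
      from line_deriv_integral[OF F \<open>r > 0\<close> rU(5)[OF this]] show ?thesis by simp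
    qed
    ultimately have "(\<lambda>\<zeta>. line_deriv b F (complex_line a c \<zeta>)) holomorphic_on ball \<zeta> e"
      by (rule holomorphic_transform)
    then show ?thesis
      by (rule holomorphic_on_imp_differentiable_at) (use \<open>e > 0\<close> in auto)
  qed
  then show "(\<lambda>\<zeta>. line_deriv b F (complex_line a c \<zeta>)) holomorphic_on ?S"
    by (simp add: holomorphic_on_def field_differentiable_at_within)
qed

text \<open>For total differentiability it suffices that one partial derivative exists at the point
  and the other exists nearby and is continuous.\<close>

lemma line_holo_has_derivative:
  assumes F: "line_holo \<Omega> F" and "open \<Omega>" and z: "z \<in> \<Omega>"
  shows "(F has_derivative (\<lambda>h. line_deriv (1, 0) F z * fst h + line_deriv (0, 1) F z * snd h)) (at z)"
proof -
  obtain X Y where XY: "open X" "open Y" "z \<in> X \<times> Y" "X \<times> Y \<subseteq> \<Omega>"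
    using open_prod_elim[OF \<open>open \<Omega>\<close> z] by blast
  \<comment> \<open>The second factor becomes a ball because the criterion for partial derivatives
    needs convexity in the variable whose partial derivative is continuous.\<close>
  obtain e where e: "e > 0" "ball (snd z) e \<subseteq> Y"
    using XY open_contains_ball[of Y] by (auto simp: mem_Times_iff)
  let ?Y = "ball (snd z) e"
  have sub: "X \<times> ?Y \<subseteq> \<Omega>" using XY e by auto
  have zin: "z \<in> X \<times> ?Y" using XY e by (auto simp: mem_Times_iff)
  have op: "open (X \<times> ?Y)" using XY by (intro open_Times) auto
  have dx: "((\<lambda>x. F (x, y)) has_derivative (\<lambda>h. line_deriv (1, 0) F (x0, y) * h)) (at x0)"
    if "(x0, y) \<in> \<Omega>" for x0 y
    using has_field_derivative_line_deriv[OF F \<open>open \<Omega>\<close>, of "(0, y)" "(1, 0)" x0] that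
    by (simp add: complex_line_def has_field_derivative_def)
  have dy: "((\<lambda>y. F (x, y)) has_derivative blinfun_apply (blinfun_mult_right (line_deriv (0, 1) F (x, y0)))) (at y0)"
    if "(x, y0) \<in> \<Omega>" for x y0
    using has_field_derivative_line_deriv[OF F \<open>open \<Omega>\<close>, of "(x, 0)" "(0, 1)" y0] that
    by (simp add: complex_line_def has_field_derivative_def blinfun_mult_right.rep_eq)
  have "((\<lambda>(x, y). F (x, y)) has_derivative
      (\<lambda>(tx, ty). line_deriv (1, 0) F (fst z, snd z) * tx
          + blinfun_apply (blinfun_mult_right (line_deriv (0, 1) F (fst z, snd z))) ty)) (at (fst z, snd z) within X \<times> ?Y)"
  proof (rule has_derivative_partialsI[where f = "\<lambda>x y. F (x, y)"
        and fy = "\<lambda>x y. blinfun_mult_right (line_deriv (0, 1) F (x, y))"])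
    show "((\<lambda>x. F (x, snd z)) has_derivative (*) (line_deriv (1, 0) F (fst z, snd z))) (at (fst z) within X)"
      using dx[of "fst z" "snd z"] z by (simp add: has_derivative_at_withinI)
    show "((\<lambda>y. F (x, y)) has_derivative blinfun_apply (blinfun_mult_right (line_deriv (0, 1) F (x, y)))) (at y within ?Y)"
      if "x \<in> X" "y \<in> ?Y" for x y
      by (rule has_derivative_at_withinI, rule dy) (use sub that in blast)
    have "continuous_on \<Omega> (\<lambda>p. blinfun_mult_right (line_deriv (0, 1) F p))"
      by (rule bounded_linear.continuous_on[OF bounded_linear_blinfun_mult_right continuous_on_line_deriv[OF F \<open>open \<Omega>\<close>]])
    then have "continuous_on (X \<times> ?Y) (\<lambda>p. blinfun_mult_right (line_deriv (0, 1) F p))"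
      using sub continuous_on_subset by blast
    then have "continuous (at z within X \<times> ?Y) (\<lambda>p. blinfun_mult_right (line_deriv (0, 1) F p))"
      using zin unfolding continuous_on_eq_continuous_within by blast
    then show "continuous (at (fst z, snd z) within X \<times> ?Y) (\<lambda>(x, y). blinfun_mult_right (line_deriv (0, 1) F (x, y)))"
      by (simp add: case_prod_unfold)
  qed (use e in auto)
  then have "(F has_derivative
      (\<lambda>(tx, ty). line_deriv (1, 0) F z * tx + line_deriv (0, 1) F z * ty)) (at z within X \<times> ?Y)"
    by simp
  then show ?thesis
    using at_within_open[OF zin op] by (simp add: case_prod_unfold)
qed

section \<open>Real second-order calculus for real parts of holomorphic functions\<close>

lemma bounded_linear_Blinfun_euclidean:
  fixes f :: "'a::euclidean_space \<Rightarrow> 'b::euclidean_space \<Rightarrow> 'c::real_normed_vector"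
  assumes "\<And>x. linear (f x)" "\<And>y. linear (\<lambda>x. f x y)"
  shows "blinfun_apply (Blinfun (f x)) = f x" "bounded_linear (\<lambda>x. Blinfun (f x))"
proof -
  have bl: "blinfun_apply (Blinfun (f x)) = f x" for x
    using assms(1) by (simp add: bounded_linear_Blinfun_apply linear_conv_bounded_linear)
  then show "blinfun_apply (Blinfun (f x)) = f x" .
  have "linear (\<lambda>x. Blinfun (f x))"
    using linear_add[OF assms(2)] linear_cmul[OF assms(2)]
    by (intro linearI blinfun_eqI) (simp_all add: bl blinfun.add_left blinfun.scaleR_left)
  then show "bounded_linear (\<lambda>x. Blinfun (f x))"
    by (simp add: linear_conv_bounded_linear)
qed

text \<open>These forms depend linearly on their complex coefficients. Hence the real derivative
  fields wanted by \<open>has_C2_derivs_on\<close> are bounded linear images of complex derivatives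
  and inherit their differentiability and continuity. The coefficient of
  \<open>re_form2_deriv\<close> is a Hessian, one row for each first partial derivative.\<close>

definition re_form :: "complex \<Rightarrow> complex \<Rightarrow>\<^sub>L real" where
  "re_form c = Blinfun (\<lambda>h. Re (c * h))"

definition re_form_deriv :: "complex \<Rightarrow> complex \<Rightarrow>\<^sub>L complex \<Rightarrow>\<^sub>L real" where
  "re_form_deriv c = Blinfun (\<lambda>h. re_form (c * h))"

definition re_form2 :: "complex \<times> complex \<Rightarrow> (complex \<times> complex) \<Rightarrow>\<^sub>L real" where
  "re_form2 c = Blinfun (\<lambda>h. Re (fst c * fst h + snd c * snd h))"

definition re_form2_deriv ::
    "(complex \<times> complex) \<times> (complex \<times> complex) \<Rightarrow>
      (complex \<times> complex) \<Rightarrow>\<^sub>L (complex \<times> complex) \<Rightarrow>\<^sub>L real" where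
  "re_form2_deriv c = Blinfun (\<lambda>h. re_form2
     (fst (fst c) * fst h + snd (fst c) * snd h, fst (snd c) * fst h + snd (snd c) * snd h))"

lemma re_form: "blinfun_apply (re_form c) = (\<lambda>h. Re (c * h))" "bounded_linear re_form"
  unfolding re_form_def
  by (rule bounded_linear_Blinfun_euclidean; auto intro!: linearI simp: algebra_simps)+

lemma re_form_deriv: "blinfun_apply (re_form_deriv c) = (\<lambda>h. re_form (c * h))" "bounded_linear re_form_deriv"
  unfolding re_form_deriv_def
  by (rule bounded_linear_Blinfun_euclidean;
      auto intro!: linearI blinfun_eqI simp: re_form blinfun.add_left blinfun.scaleR_left algebra_simps)+

lemma re_form2: "blinfun_apply (re_form2 c) = (\<lambda>h. Re (fst c * fst h + snd c * snd h))" "bounded_linear re_form2"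
  unfolding re_form2_def
  by (rule bounded_linear_Blinfun_euclidean; auto intro!: linearI simp: algebra_simps)+

lemma re_form2_deriv:
  "blinfun_apply (re_form2_deriv c) = (\<lambda>h. re_form2
     (fst (fst c) * fst h + snd (fst c) * snd h, fst (snd c) * fst h + snd (snd c) * snd h))"
  "bounded_linear re_form2_deriv"
  unfolding re_form2_deriv_def
  by (rule bounded_linear_Blinfun_euclidean;
      auto intro!: linearI blinfun_eqI simp: re_form2 blinfun.add_left blinfun.scaleR_left algebra_simps)+

lemma has_C2_derivs_on_Re_line_holo:
  assumes F: "line_holo \<Omega> F" and "open \<Omega>"
  shows "\<exists>D D2. has_C2_derivs_on (\<lambda>z. Re (F z)) D D2 \<Omega>"
proof -
  let ?d = "\<lambda>F z. (line_deriv (1, 0) F z, line_deriv (0, 1) F z)"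
  let ?D = "\<lambda>z. re_form2 (?d F z)"
  let ?D2 = "\<lambda>z. re_form2_deriv (?d (line_deriv (1, 0) F) z, ?d (line_deriv (0, 1) F) z)"
  have hol: "line_holo \<Omega> (line_deriv b F)" for b
    by (rule line_holo_line_deriv[OF assms])
  have 1: "((\<lambda>z. Re (F z)) has_derivative blinfun_apply (?D z)) (at z)" if "z \<in> \<Omega>" for z
    unfolding re_form2(1) fst_conv snd_conv
    using has_derivative_Re[OF line_holo_has_derivative[OF F \<open>open \<Omega>\<close> that]] .
  have 2: "(?D has_derivative blinfun_apply (?D2 z)) (at z)" if "z \<in> \<Omega>" for z
    using bounded_linear.has_derivative[OF re_form2(2) has_derivative_Pair
        [OF line_holo_has_derivative[OF hol \<open>open \<Omega>\<close> that] line_holo_has_derivative[OF hol \<open>open \<Omega>\<close> that]]]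
    by (simp only: re_form2_deriv(1) fst_conv snd_conv)
  have 3: "continuous_on \<Omega> ?D2"
    by (intro bounded_linear.continuous_on[OF re_form2_deriv(2)] continuous_on_Pair)
       (rule continuous_on_line_deriv[OF hol \<open>open \<Omega>\<close>])+
  have "has_C2_derivs_on (\<lambda>z. Re (F z)) ?D ?D2 \<Omega>"
    unfolding has_C2_derivs_on_def by (intro conjI ballI 1 2 3)
  then show ?thesis by blast
qed

lemma has_C2_derivs_on_Re_holomorphic:
  assumes f: "f holomorphic_on S" and "open S"
  shows "\<exists>D D2. has_C2_derivs_on (\<lambda>z. Re (f z)) D D2 S \<and>
    (\<forall>z\<in>S. blinfun_apply (blinfun_apply (D2 z) 1) 1 + blinfun_apply (blinfun_apply (D2 z) \<i>) \<i> = 0)"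
proof -
  let ?D = "\<lambda>z. re_form (deriv f z)"
  let ?D2 = "\<lambda>z. re_form_deriv (deriv (deriv f) z)"
  have f': "deriv f holomorphic_on S"
    by (rule holomorphic_deriv[OF assms])
  have 1: "((\<lambda>z. Re (f z)) has_derivative blinfun_apply (?D z)) (at z)" if "z \<in> S" for z
    unfolding re_form
    by (rule has_derivative_Re) (use holomorphic_derivI[OF f \<open>open S\<close> that] in \<open>simp add: has_field_derivative_def\<close>)
  have 2: "(?D has_derivative blinfun_apply (?D2 z)) (at z)" if "z \<in> S" for z
    unfolding re_form_deriv
    by (rule bounded_linear.has_derivative[OF re_form(2)])
       (use holomorphic_derivI[OF f' \<open>open S\<close> that] in \<open>simp add: has_field_derivative_def\<close>)
  have 3: "continuous_on S ?D2"
    by (intro bounded_linear.continuous_on[OF re_form_deriv(2)] holomorphic_on_imp_continuous_on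
        holomorphic_deriv[OF f' \<open>open S\<close>])
  have "has_C2_derivs_on (\<lambda>z. Re (f z)) ?D ?D2 S"
    unfolding has_C2_derivs_on_def by (intro conjI ballI 1 2 3)
  \<comment> \<open>With f'' denoting the second complex derivative, the Laplacian is Re (f'' + \<i>
    * \<i> * f'') = 0.\<close>
  then show ?thesis
    by (intro exI[of _ ?D] exI[of _ ?D2]) (simp add: re_form re_form_deriv)
qed

text \<open>Derivatives are unique, so the fields selected by \<open>THE\<close> coincide with the
  local ones and inherit their properties. The predicate \<open>P\<close> serves to carry the
  Laplace equation along.\<close>

lemma has_C2_derivs_on_glue:
  assumes local: "\<And>x. x \<in> S \<Longrightarrow> \<exists>W D D2. open W \<and> x \<in> W \<and> has_C2_derivs_on f D D2 W \<and> (\<forall>y\<in>W. P (D2 y))"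
  shows "\<exists>D D2. has_C2_derivs_on f D D2 S \<and> (\<forall>x\<in>S. P (D2 x))"
proof -
  define D where "D x = (THE d. (f has_derivative blinfun_apply d) (at x))" for x
  define D2 where "D2 x = (THE d. (D has_derivative blinfun_apply d) (at x))" for x
  have uniq: "(THE d. (g has_derivative blinfun_apply d) (at x)) = d0"
    if "(g has_derivative blinfun_apply d0) (at x)" for g :: "'a \<Rightarrow> 'c::real_normed_vector" and d0 x
    using that by (intro the_equality) (auto intro: has_derivative_unique blinfun_apply_inject[THEN iffD1])
  have main: "(f has_derivative blinfun_apply (D x)) (at x) \<and> (D has_derivative blinfun_apply (D2 x)) (at x)
      \<and> isCont D2 x \<and> P (D2 x)" if x: "x \<in> S" for x
  proof -
    obtain W E E2 where W: "open W" "x \<in> W" "has_C2_derivs_on f E E2 W" "\<forall>y\<in>W. P (E2 y)"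
      using local[OF x] by blast
    have E: "(f has_derivative blinfun_apply (E y)) (at y)" if "y \<in> W" for y
      using W(3) that by (simp add: has_C2_derivs_on_def)
    have DE: "D y = E y" if "y \<in> W" for y
      unfolding D_def by (rule uniq[OF E[OF that]])
    have E2: "(D has_derivative blinfun_apply (E2 y)) (at y)" if "y \<in> W" for y
    proof (rule has_derivative_transform_within_open[OF _ \<open>open W\<close> that])
      show "(E has_derivative blinfun_apply (E2 y)) (at y)"
        using W(3) that by (simp add: has_C2_derivs_on_def)
    qed (simp add: DE)
    have D2E: "D2 y = E2 y" if "y \<in> W" for y
      unfolding D2_def by (rule uniq[OF E2[OF that]])
    have "continuous_on W D2"
      using W(3) D2E by (simp add: has_C2_derivs_on_def cong: continuous_on_cong)
    then have "isCont D2 x"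
      using W(1,2) continuous_on_eq_continuous_at by blast
    then show ?thesis
      using E[OF W(2)] E2[OF W(2)] W(2,4) by (simp add: DE D2E)
  qed
  then have "has_C2_derivs_on f D D2 S" "\<forall>x\<in>S. P (D2 x)"
    by (auto simp: has_C2_derivs_on_def continuous_at_imp_continuous_on)
  then show ?thesis by blast
qed

section \<open>Functions that are locally real parts of holomorphic functions\<close>

text \<open>The holomorphic function may change from one neighbourhood to the next, so different
  branches of a logarithm never conflict. The inclusion of \<open>W\<close> in \<Omega> forces
  \<Omega> to be open.\<close>

definition locally_Re_holo :: "(complex \<times> complex) set \<Rightarrow> (complex \<times> complex \<Rightarrow> real) \<Rightarrow> bool" where
  "locally_Re_holo \<Omega> u \<longleftrightarrow> (\<forall>z\<in>\<Omega>. \<exists>W F. open W \<and> z \<in> W \<and> W \<subseteq> \<Omega> \<and> line_holo W F \<and> (\<forall>w\<in>W. u w = Re (F w)))"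

lemma locally_Re_holoE:
  assumes "locally_Re_holo \<Omega> u" "z \<in> \<Omega>"
  obtains W F where "open W" "z \<in> W" "W \<subseteq> \<Omega>" "line_holo W F" "\<And>w. w \<in> W \<Longrightarrow> u w = Re (F w)"
proof -
  from assms(1)[unfolded locally_Re_holo_def, THEN bspec, OF assms(2)]
  obtain W F where "open W" "z \<in> W" "W \<subseteq> \<Omega>" "line_holo W F" "\<forall>w\<in>W. u w = Re (F w)"
    by (elim exE conjE)
  then show ?thesis by (intro that[of W F]) simp_all
qed

lemma locally_Re_holo_imp_open: "locally_Re_holo \<Omega> u \<Longrightarrow> open \<Omega>"
  by (subst open_subopen) (meson locally_Re_holoE)

lemma has_C2_derivs_on_cong:
  assumes "has_C2_derivs_on g D D2 S" "open S" "\<And>x. x \<in> S \<Longrightarrow> f x = g x"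
  shows "has_C2_derivs_on f D D2 S"
proof -
  have "(f has_derivative blinfun_apply (D x)) (at x)" if "x \<in> S" for x
    using has_derivative_transform_within_open[of g "blinfun_apply (D x)" x UNIV S f] assms that
    by (auto simp: has_C2_derivs_on_def)
  with assms(1) show ?thesis by (simp add: has_C2_derivs_on_def)
qed

text \<open>All requirements are local. On a complex line the function is locally the real part of a
  holomorphic function of one variable, which is harmonic.\<close>

lemma locally_Re_holo_imp_pluriharmonic_on:
  assumes "locally_Re_holo \<Omega> u"
  shows "pluriharmonic_on \<Omega> u"
  unfolding pluriharmonic_on_def harmonic_on_def
proof (intro conjI allI)
  show op: "open \<Omega>" by (rule locally_Re_holo_imp_open[OF assms])
  have "\<exists>D D2. has_C2_derivs_on u D D2 \<Omega> \<and> (\<forall>x\<in>\<Omega>. (\<lambda>_. True) (D2 x))"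
  proof (rule has_C2_derivs_on_glue[where P = "\<lambda>_. True"])
    fix z assume "z \<in> \<Omega>"
    obtain W F where W: "open W" "z \<in> W" "W \<subseteq> \<Omega>" "line_holo W F" "\<And>w. w \<in> W \<Longrightarrow> u w = Re (F w)"
      by (rule locally_Re_holoE[OF assms \<open>z \<in> \<Omega>\<close>]) blast
    obtain D D2 where "has_C2_derivs_on (\<lambda>z. Re (F z)) D D2 W"
      using has_C2_derivs_on_Re_line_holo[OF W(4,1)] by blast
    then have "has_C2_derivs_on u D D2 W"
      by (rule has_C2_derivs_on_cong) (use W in auto)
    then show "\<exists>W D D2. open W \<and> z \<in> W \<and> has_C2_derivs_on u D D2 W \<and> (\<forall>y\<in>W. True)"
      using W(1,2) by blast
  qed
  then show "\<exists>D D2. has_C2_derivs_on u D D2 \<Omega>" by blast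
  fix a b
  let ?S = "\<lambda>W. {\<zeta>. complex_line a b \<zeta> \<in> W}"
  show "open (?S \<Omega>)" by (rule open_complex_line_vimage[OF op])
  show "\<exists>D D2. has_C2_derivs_on (\<lambda>\<zeta>. u (complex_line a b \<zeta>)) D D2 (?S \<Omega>) \<and>
      (\<forall>\<zeta>\<in>?S \<Omega>. blinfun_apply (blinfun_apply (D2 \<zeta>) 1) 1 + blinfun_apply (blinfun_apply (D2 \<zeta>) \<i>) \<i> = 0)"
  proof (rule has_C2_derivs_on_glue
      [where P = "\<lambda>A. blinfun_apply (blinfun_apply A 1) 1 + blinfun_apply (blinfun_apply A \<i>) \<i> = 0"])
    fix \<zeta> assume "\<zeta> \<in> ?S \<Omega>"
    then have "complex_line a b \<zeta> \<in> \<Omega>" by simp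
    obtain W F where W: "open W" "complex_line a b \<zeta> \<in> W" "W \<subseteq> \<Omega>" "line_holo W F" "\<And>w. w \<in> W \<Longrightarrow> u w = Re (F w)"
      by (rule locally_Re_holoE[OF assms \<open>complex_line a b \<zeta> \<in> \<Omega>\<close>]) blast
    have S: "open (?S W)" by (rule open_complex_line_vimage[OF W(1)])
    obtain D D2 where *: "has_C2_derivs_on (\<lambda>\<zeta>. Re (F (complex_line a b \<zeta>))) D D2 (?S W)"
       "\<forall>\<zeta>\<in>?S W. blinfun_apply (blinfun_apply (D2 \<zeta>) 1) 1 + blinfun_apply (blinfun_apply (D2 \<zeta>) \<i>) \<i> = 0"
      using has_C2_derivs_on_Re_holomorphic[OF line_holoD(2)[OF W(4)] S] by blast
    have "has_C2_derivs_on (\<lambda>\<zeta>. u (complex_line a b \<zeta>)) D D2 (?S W)"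
      by (rule has_C2_derivs_on_cong[OF *(1) S]) (use W in auto)
    then show "\<exists>V D D2. open V \<and> \<zeta> \<in> V \<and> has_C2_derivs_on (\<lambda>\<zeta>. u (complex_line a b \<zeta>)) D D2 V \<and>
        (\<forall>\<zeta>\<in>V. blinfun_apply (blinfun_apply (D2 \<zeta>) 1) 1 + blinfun_apply (blinfun_apply (D2 \<zeta>) \<i>) \<i> = 0)"
      using S W(2) *(2) by blast
  qed
qed

section \<open>The sub-mean value property\<close>

lemma log_plus_eq_ln_max: "t \<ge> 0 \<Longrightarrow> log_plus t = ln (max 1 t)"
  by (cases "t = 0"; cases "t \<le> 1") (auto simp: log_plus_def max_def)

lemma log_plus_nonneg: "0 \<le> log_plus t"
  by (simp add: log_plus_def)

lemma log_plus_mono: "0 \<le> s \<Longrightarrow> s \<le> t \<Longrightarrow> log_plus s \<le> log_plus t"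
  by (simp add: log_plus_eq_ln_max)

lemma ln_le_log_plus: "ln t \<le> log_plus t"
  by (simp add: log_plus_def)

lemma continuous_on_log_plus [continuous_intros]:
  assumes "continuous_on S f" "\<And>x. x \<in> S \<Longrightarrow> 0 \<le> f x"
  shows "continuous_on S (\<lambda>x. log_plus (f x))"
proof -
  have "continuous_on S (\<lambda>x. ln (max 1 (f x)))"
    using assms(1) by (intro continuous_intros ballI) (auto simp: max_def)
  then show ?thesis
    by (rule continuous_on_eq) (simp add: log_plus_eq_ln_max assms(2))
qed

text \<open>Blaschke factors: a root \<open>w\<close> in the open unit disc is reflected by replacing \<open>z - w\<close> with
  \<open>1 - cnj w * z\<close>, which has the same modulus on the circle.\<close>

lemma poly_reflect_roots:
  fixes p :: "complex poly"
  assumes "p \<noteq> 0"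
  shows "\<exists>q. (\<forall>z. cmod z < 1 \<longrightarrow> poly q z \<noteq> 0) \<and> (\<forall>z. cmod z = 1 \<longrightarrow> cmod (poly q z) = cmod (poly p z)) \<and>
    cmod (poly p 0) \<le> cmod (poly q 0)"
  using assms
proof (induction "degree p" arbitrary: p)
  case 0
  then have "poly p z \<noteq> 0" for z
    by (metis degree_eq_zeroE mult_zero_right pCons_0_0 poly_0 poly_pCons add.right_neutral)
  then show ?case by blast
next
  case (Suc n)
  then obtain w where "poly p w = 0"
    by (metis constant_degree fundamental_theorem_of_algebra nat.distinct(1))
  then obtain p' where p: "p = [:-w, 1:] * p'"
    using poly_eq_0_iff_dvd by (metis dvdE)
  with Suc.prems Suc.hyps(2) have "p' \<noteq> 0" "degree p' = n"
    by (auto simp: degree_mult_eq simp del: mult_pCons_left)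
  then obtain q where q: "\<And>z. cmod z < 1 \<Longrightarrow> poly q z \<noteq> 0"
      "\<And>z. cmod z = 1 \<Longrightarrow> cmod (poly q z) = cmod (poly p' z)" "cmod (poly p' 0) \<le> cmod (poly q 0)"
    using Suc.hyps(1)[of p'] by auto
  show ?case
  proof (cases "cmod w < 1")
    \<comment> \<open>Roots of modulus at least 1 are kept, including those on the unit circle,
      which reflection would not move.\<close>
    case False
    have "poly ([:-w, 1:] * q) z \<noteq> 0" if "cmod z < 1" for z
      using q(1)[OF that] that False by auto
    moreover have "cmod (poly ([:-w, 1:] * q) z) = cmod (poly p z)" if "cmod z = 1" for z
      using q(2)[OF that] by (simp add: p norm_mult del: mult_pCons_left)
    moreover have "cmod (poly p 0) \<le> cmod (poly ([:-w, 1:] * q) 0)"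
      using q(3) by (simp add: p norm_mult mult_left_mono del: mult_pCons_left)
    ultimately show ?thesis by blast
  next
    case True
    have "poly ([:1, -cnj w:] * q) z \<noteq> 0" if "cmod z < 1" for z
    proof -
      have "cmod (z * cnj w) < 1"
        using that True by (metis complex_mod_cnj mult_strict_mono' norm_ge_zero norm_mult mult_1)
      then have "1 \<noteq> z * cnj w" by auto
      then show ?thesis using q(1)[OF that] by simp
    qed
    moreover have "cmod (poly ([:1, -cnj w:] * q) z) = cmod (poly p z)" if "cmod z = 1" for z
    proof -
      have "z * cnj z = 1" using that by (simp add: complex_norm_square[symmetric])
      then have "1 - z * cnj w = z * cnj (z - w)" by (simp add: algebra_simps)
      then have "cmod (1 - z * cnj w) = cmod (z - w)"
        using that by (metis complex_mod_cnj mult_1 norm_mult)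
      then show ?thesis
        using q(2)[OF that] by (simp add: p norm_mult del: mult_pCons_left)
    qed
    \<comment> \<open>At 0 the old factor has modulus |w| < 1, the reflected one modulus 1.\<close>
    moreover have "cmod (poly p 0) \<le> cmod (poly ([:1, -cnj w:] * q) 0)"
      using q(3) True mult_mono[of "cmod w" 1 "cmod (poly p' 0)" "cmod (poly q 0)"]
      by (simp add: p norm_mult del: mult_pCons_left)
    ultimately show ?thesis by blast
  qed
qed

lemma holomorphic_mean_value:
  fixes f :: "complex \<Rightarrow> complex"
  assumes f: "f holomorphic_on ball 0 1" and r: "0 < r" "r < 1"
  shows "((\<lambda>t. f (of_real r * cis t)) has_integral 2 * pi * f 0) {0..2*pi}"
proof -
  have sub: "cball 0 r \<subseteq> ball (0::complex) 1" using r by auto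
  have "f holomorphic_on cball 0 r"
    using f sub holomorphic_on_subset by blast
  then have "((\<lambda>u. f u / (u - 0)) has_contour_integral (2 * of_real pi * \<i> * f 0)) (circlepath 0 r)"
    using r by (intro Cauchy_integral_circlepath_simple) auto
  then have "((\<lambda>t. f (r * cis t) / (r * cis t) * r * \<i> * cis t) has_integral 2 * of_real pi * \<i> * f 0) {0..2*pi}"
    unfolding circlepath_def by (subst (asm) has_contour_integral_part_circlepath_iff) auto
  then have "((\<lambda>t. (- \<i>) * (f (r * cis t) / (r * cis t) * r * \<i> * cis t)) has_integral (- \<i>) * (2 * of_real pi * \<i> * f 0)) {0..2*pi}"
    by (rule has_integral_mult_right)
  moreover have "(- \<i>) * (f (r * cis t) / (r * cis t) * r * \<i> * cis t) = f (r * cis t)" for t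
    using r by (simp add: field_simps)
  ultimately show ?thesis by (simp add: algebra_simps)
qed

text \<open>If |p(0)| <= 1 the left side is 0. Otherwise reflect the roots in the disc: ln |q| is
  then the real part of a holomorphic \<open>L\<close>, equal at 0 to its mean over each circle of
  radius r < 1 and dominated by log_plus |q|. Roots of \<open>q\<close> on the unit circle rule out
  r = 1 for \<open>L\<close>, but log_plus |q| is continuous there and the inequality survives the
  limit.\<close>

lemma log_plus_poly_submean:
  "2 * pi * log_plus (cmod (poly p 0)) \<le> integral {0..2*pi} (\<lambda>t. log_plus (cmod (poly p (cis t))))"
proof (cases "p = 0 \<or> cmod (poly p 0) \<le> 1")
  case True
  then have "log_plus (cmod (poly p 0)) = 0"
    by (auto simp: log_plus_eq_ln_max max_def)
  moreover have "0 \<le> integral {0..2*pi} (\<lambda>t. log_plus (cmod (poly p (cis t))))"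
    by (intro integral_nonneg integrable_continuous_real continuous_intros log_plus_nonneg norm_ge_zero)
  ultimately show ?thesis by simp
next
  case False
  then obtain q where q: "\<And>z. cmod z < 1 \<Longrightarrow> poly q z \<noteq> 0"
      "\<And>z. cmod z = 1 \<Longrightarrow> cmod (poly q z) = cmod (poly p z)" "cmod (poly p 0) \<le> cmod (poly q 0)"
    using poly_reflect_roots[of p] by auto
  obtain L where L: "L holomorphic_on ball 0 1" "\<And>z. z \<in> ball 0 1 \<Longrightarrow> exp (L z) = poly q z"
    by (rule holomorphic_logarithm_exists[of "ball 0 1" "poly q" 0])
       (use q in \<open>auto intro!: holomorphic_intros\<close>)
  have ReL: "Re (L z) = ln (cmod (poly q z))" if "z \<in> ball 0 1" for z
    using L(2)[OF that, symmetric] by simp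
  let ?I = "\<lambda>r. integral (cbox 0 (2*pi)) (\<lambda>t. log_plus (cmod (poly q (of_real r * cis t))))"
  \<comment> \<open>The closure of the open interval contains 1, the radius to be reached.\<close>
  have cont: "continuous_on (closure {0<..<1::real}) ?I"
  proof (rule integral_continuous_on_param)
    show "continuous_on (closure {0<..<1::real} \<times> cbox 0 (2*pi)) (\<lambda>(r, t). log_plus (cmod (poly q (of_real r * cis t))))"
      unfolding case_prod_unfold by (intro continuous_intros norm_ge_zero)
  qed
  have "2 * pi * log_plus (cmod (poly p 0)) \<le> ?I r" if "r \<in> {0<..<1}" for r
  proof -
    have "((\<lambda>t. Re (L (of_real r * cis t))) has_integral Re (2 * pi * L 0)) {0..2*pi}"
      using holomorphic_mean_value[OF L(1), of r] that
      by (intro has_integral_Re) auto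
    then have *: "((\<lambda>t. Re (L (of_real r * cis t))) has_integral 2 * pi * Re (L 0)) {0..2*pi}"
      by simp
    have "log_plus (cmod (poly p 0)) = ln (cmod (poly p 0))"
      using False by (simp add: log_plus_def)
    also have "\<dots> \<le> ln (cmod (poly q 0))"
      using False q(3) by (intro ln_mono) auto
    also have "\<dots> = Re (L 0)" by (simp add: ReL)
    finally have "2 * pi * log_plus (cmod (poly p 0)) \<le> 2 * pi * Re (L 0)" by simp
    also have "\<dots> \<le> ?I r"
    proof (rule has_integral_le[OF *])
      show "((\<lambda>t. log_plus (cmod (poly q (of_real r * cis t)))) has_integral ?I r) {0..2*pi}"
        unfolding cbox_interval
        by (intro integrable_integral integrable_continuous_real continuous_intros norm_ge_zero)
      show "Re (L (of_real r * cis t)) \<le> log_plus (cmod (poly q (of_real r * cis t)))" for t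
        using that by (subst ReL) (auto simp: norm_mult intro: ln_le_log_plus)
    qed
    finally show ?thesis .
  qed
  then have "2 * pi * log_plus (cmod (poly p 0)) \<le> ?I 1"
    by (rule continuous_ge_on_closure[OF cont, rotated]) auto
  also have "?I 1 = integral {0..2*pi} (\<lambda>t. log_plus (cmod (poly p (cis t))))"
    by (simp add: q(2))
  finally show ?thesis .
qed

section \<open>Circle means and plurisubharmonicity\<close>

text \<open>Nonnegativity kills the negative part, so the extended integral reduces to an ordinary
  one; \<open>uniform_measure\<close> contributes the division by the length 2 pi.\<close>

lemma circle_mean_ereal:
  assumes g: "continuous_on UNIV (\<lambda>t. v (cis t))" and nn: "\<And>z. 0 \<le> v z"
  shows "circle_mean (\<lambda>z. ereal (v z)) = ereal (integral {0..2*pi} (\<lambda>t. v (cis t)) / (2 * pi))"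
proof -
  let ?g = "\<lambda>t. v (cis t)"
  have [measurable]: "?g \<in> borel_measurable borel"
    using g by (rule borel_measurable_continuous_onI)
  have int: "(?g has_integral integral {0..2*pi} ?g) {0..2*pi}"
    using continuous_on_subset[OF g subset_UNIV] by (intro integrable_integral integrable_continuous_real)
  have "(\<integral>\<^sup>+ t. ennreal (?g t) * indicator {0..2*pi} t \<partial>lborel) = ennreal (integral {0..2*pi} ?g)"
    using nn_integral_has_integral_lebesgue[OF nn int]
    by (simp add: ennreal_indicator ennreal_mult' ennreal_mult[OF nn, symmetric] mult.commute nn_integral_set_ennreal)
  then have "(\<integral>\<^sup>+ t. ennreal (?g t) \<partial>uniform_measure lborel {0..2*pi}) = ennreal (integral {0..2*pi} ?g) / ennreal (2 * pi)"
    by (subst nn_integral_uniform_measure) auto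
  also have "\<dots> = ennreal (integral {0..2*pi} ?g / (2 * pi))"
    by (intro divide_ennreal integral_nonneg) (use int nn in auto)
  finally have 1: "(\<integral>\<^sup>+ t. e2ennreal (ereal (?g t)) \<partial>uniform_measure lborel {0..2*pi}) = ennreal (integral {0..2*pi} ?g / (2 * pi))"
    by simp
  have 2: "e2ennreal (- ereal (?g t)) = 0" for t
    using nn by (simp add: e2ennreal_neg ennreal_neg)
  have "0 \<le> integral {0..2*pi} ?g / (2 * pi)"
    using int nn by (intro divide_nonneg_pos integral_nonneg) auto
  then show ?thesis
    unfolding circle_mean_def ereal_integral_def 1 2 by (simp add: enn2ereal_ennreal zero_ennreal.rep_eq)
qed

lemma plurisubharmonic_onI_continuous:
  assumes cont: "continuous_on UNIV u" and nn: "\<And>z. 0 \<le> u z"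
    and submean: "\<And>a b. 2 * pi * u a \<le> integral {0..2*pi} (\<lambda>t. u (complex_line a b (cis t)))"
  shows "plurisubharmonic_on UNIV (\<lambda>z. ereal (u z))"
  unfolding plurisubharmonic_on_def
proof (intro conjI allI impI ballI)
  show "open {z \<in> UNIV. ereal (u z) < c}" for c
  proof -
    have "continuous_on UNIV (\<lambda>z. ereal (u z))"
      using cont by (intro continuous_intros)
    then show ?thesis
      using open_Collect_less[of "\<lambda>z. ereal (u z)" "\<lambda>_. c"] by simp
  qed
  show "\<exists>z\<in>C. ereal (u z) \<noteq> -\<infinity>" if "C \<in> components UNIV" for C
    using in_components_nonempty[OF that] by auto
  fix a b
  have "continuous_on UNIV (\<lambda>t. u (complex_line a b (cis t)))"
    unfolding complex_line_def by (intro continuous_on_compose2[OF cont] continuous_intros) auto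
  then have "circle_mean (\<lambda>\<zeta>. ereal (u (complex_line a b \<zeta>))) =
      ereal (integral {0..2*pi} (\<lambda>t. u (complex_line a b (cis t))) / (2 * pi))"
    by (rule circle_mean_ereal) (rule nn)
  then show "ereal (u a) \<le> circle_mean (\<lambda>\<zeta>. ereal (u (complex_line a b \<zeta>)))"
    using submean[of a b] by (simp add: field_simps)
qed auto

section \<open>Degree and dynamics of Henon maps\<close>

lemma poly_fun_deg_le_monomial:
  assumes "i + j \<le> n"
  shows "poly_fun_deg_le n (\<lambda>z. c * fst z ^ i * snd z ^ j)"
  unfolding poly_fun_deg_le_def
proof (intro exI allI)
  let ?c = "\<lambda>i' j'. if i' = i then if j' = j then c else 0 else 0"
  fix x y :: complex
  have inner: "(\<Sum>j'\<le>n - i'. ?c i' j' * x ^ i' * y ^ j') = (if i' = i then c * x ^ i * y ^ j else 0)" for i'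
  proof (cases "i' = i")
    case True
    have "(\<Sum>j'\<le>n - i'. ?c i' j' * x ^ i' * y ^ j') = (\<Sum>j'\<le>n - i. if j' = j then c * x ^ i * y ^ j else 0)"
      using True by (intro sum.cong) simp_all
    then show ?thesis using True assms by simp
  qed simp
  have "c * x ^ i * y ^ j = (\<Sum>i'\<le>n. if i' = i then c * x ^ i * y ^ j else 0)"
    using assms by simp
  also have "\<dots> = (\<Sum>i'\<le>n. \<Sum>j'\<le>n - i'. ?c i' j' * x ^ i' * y ^ j')"
    by (simp only: inner)
  finally show "c * fst (x, y) ^ i * snd (x, y) ^ j = (\<Sum>i'\<le>n. \<Sum>j'\<le>n - i'. ?c i' j' * x ^ i' * y ^ j')"
    by simp
qed

lemma poly_fun_deg_le_0: "poly_fun_deg_le n (\<lambda>_. 0)"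
  using poly_fun_deg_le_monomial[of 0 0 n 0] by simp

lemma poly_fun_deg_le_add:
  assumes "poly_fun_deg_le n f" "poly_fun_deg_le n g"
  shows "poly_fun_deg_le n (\<lambda>z. f z + g z)"
proof -
  from assms(1) obtain c where "\<forall>x y. f (x, y) = (\<Sum>i\<le>n. \<Sum>j\<le>n - i. c i j * x ^ i * y ^ j)"
    unfolding poly_fun_deg_le_def ..
  moreover from assms(2) obtain c' where "\<forall>x y. g (x, y) = (\<Sum>i\<le>n. \<Sum>j\<le>n - i. c' i j * x ^ i * y ^ j)"
    unfolding poly_fun_deg_le_def ..
  ultimately have "f (x, y) + g (x, y) = (\<Sum>i\<le>n. \<Sum>j\<le>n - i. (c i j + c' i j) * x ^ i * y ^ j)" for x y
    by (simp add: sum.distrib algebra_simps)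
  then show ?thesis
    unfolding poly_fun_deg_le_def by (intro exI[of _ "\<lambda>i j. c i j + c' i j"]) simp
qed

lemma poly_fun_deg_le_sum:
  assumes "finite I" "\<And>i. i \<in> I \<Longrightarrow> poly_fun_deg_le n (f i)"
  shows "poly_fun_deg_le n (\<lambda>z. \<Sum>i\<in>I. f i z)"
  using assms by (induction I rule: finite_induct) (auto intro: poly_fun_deg_le_0 poly_fun_deg_le_add)

lemma poly_fun_deg_leE:
  assumes "poly_fun_deg_le n f"
  obtains c where "f = (\<lambda>z. \<Sum>i\<le>n. \<Sum>j\<le>n - i. c i j * fst z ^ i * snd z ^ j)"
proof -
  from assms obtain c where c: "\<forall>x y. f (x, y) = (\<Sum>i\<le>n. \<Sum>j\<le>n - i. c i j * x ^ i * y ^ j)"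
    unfolding poly_fun_deg_le_def ..
  have "f z = (\<Sum>i\<le>n. \<Sum>j\<le>n - i. c i j * fst z ^ i * snd z ^ j)" for z
    by (cases z) (simp add: c)
  then show ?thesis by (intro that ext)
qed

lemma poly_fun_deg_le_mono:
  assumes "poly_fun_deg_le n f" "n \<le> m"
  shows "poly_fun_deg_le m f"
proof -
  obtain c where c: "f = (\<lambda>z. \<Sum>i\<le>n. \<Sum>j\<le>n - i. c i j * fst z ^ i * snd z ^ j)"
    using assms(1) by (rule poly_fun_deg_leE)
  show ?thesis
    unfolding c by (intro poly_fun_deg_le_sum poly_fun_deg_le_monomial) (use assms(2) in auto)
qed

lemma poly_fun_deg_le_mult:
  assumes "poly_fun_deg_le n f" "poly_fun_deg_le m g"
  shows "poly_fun_deg_le (n + m) (\<lambda>z. f z * g z)"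
proof -
  obtain c where c: "f = (\<lambda>z. \<Sum>i\<le>n. \<Sum>j\<le>n - i. c i j * fst z ^ i * snd z ^ j)"
    using assms(1) by (rule poly_fun_deg_leE)
  obtain c' where c': "g = (\<lambda>z. \<Sum>i\<le>m. \<Sum>j\<le>m - i. c' i j * fst z ^ i * snd z ^ j)"
    using assms(2) by (rule poly_fun_deg_leE)
  have "f z * g z = (\<Sum>i\<le>n. \<Sum>i'\<le>m. \<Sum>j\<le>n - i. \<Sum>j'\<le>m - i'.
      (c i j * c' i' j') * fst z ^ (i + i') * snd z ^ (j + j'))" for z
    unfolding c c' sum_product by (intro sum.cong refl) (simp add: power_add algebra_simps)
  moreover have "poly_fun_deg_le (n + m) (\<lambda>z. \<Sum>i\<le>n. \<Sum>i'\<le>m. \<Sum>j\<le>n - i. \<Sum>j'\<le>m - i'.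
      (c i j * c' i' j') * fst z ^ (i + i') * snd z ^ (j + j'))"
    by (intro poly_fun_deg_le_sum poly_fun_deg_le_monomial) auto
  ultimately show ?thesis by simp
qed

lemma poly_fun_deg_le_power:
  assumes "poly_fun_deg_le n f"
  shows "poly_fun_deg_le (k * n) (\<lambda>z. f z ^ k)"
proof (induction k)
  case 0
  show ?case using poly_fun_deg_le_monomial[of 0 0 0 1] by simp
next
  case (Suc k)
  then show ?case using poly_fun_deg_le_mult[OF assms Suc] by simp
qed

lemma poly_fun_deg_le_cmult:
  assumes "poly_fun_deg_le n f"
  shows "poly_fun_deg_le n (\<lambda>z. c * f z)"
  using poly_fun_deg_le_mult[OF poly_fun_deg_le_monomial[of 0 0 0 c] assms] by simp

lemma poly_fun_deg_le_poly:
  assumes "poly_fun_deg_le n f"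
  shows "poly_fun_deg_le (degree p * n) (\<lambda>z. poly p (f z))"
  unfolding poly_altdef
  by (intro poly_fun_deg_le_sum poly_fun_deg_le_cmult
      poly_fun_deg_le_mono[OF poly_fun_deg_le_power[OF assms]]) auto

definition deg_bounded_map :: "nat \<Rightarrow> (complex \<times> complex \<Rightarrow> complex \<times> complex) \<Rightarrow> bool" where
  "deg_bounded_map n F \<longleftrightarrow> poly_fun_deg_le n (\<lambda>z. fst (F z)) \<and> poly_fun_deg_le n (\<lambda>z. snd (F z))"

lemma deg_bounded_map_elementary:
  assumes "deg_bounded_map n F" "degree p \<ge> 2"
  shows "deg_bounded_map (degree p * n) (elementary_henon a p \<circ> F)"
proof -
  have n: "n \<le> degree p * n" using assms(2) mult_le_mono1[of 1 "degree p" n] by simp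
  have "poly_fun_deg_le (degree p * n) (\<lambda>z. poly p (snd (F z)) + (- a) * fst (F z))"
    using assms(1) n unfolding deg_bounded_map_def
    by (intro poly_fun_deg_le_add poly_fun_deg_le_poly poly_fun_deg_le_cmult) (auto intro: poly_fun_deg_le_mono)
  then show ?thesis
    using assms(1) n unfolding deg_bounded_map_def
    by (auto simp: elementary_henon_def case_prod_unfold intro: poly_fun_deg_le_mono)
qed

lemma deg_bounded_map_id: "deg_bounded_map 1 id"
  unfolding deg_bounded_map_def
  using poly_fun_deg_le_monomial[of 1 0 1 1] poly_fun_deg_le_monomial[of 0 1 1 1] by simp

text \<open>The degree is carried along syntactically, as the product of the degrees of the factors;
  it agrees with \<open>poly_map_degree\<close> by \<open>poly_map_degree_eq\<close> below.\<close>

inductive henon_degree :: "(complex \<times> complex \<Rightarrow> complex \<times> complex) \<Rightarrow> nat \<Rightarrow> bool" where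
  elementary: "a \<noteq> 0 \<Longrightarrow> degree p \<ge> 2 \<Longrightarrow> henon_degree (elementary_henon a p) (degree p)"
| compose: "a \<noteq> 0 \<Longrightarrow> degree p \<ge> 2 \<Longrightarrow> henon_degree F d \<Longrightarrow>
    henon_degree (elementary_henon a p \<circ> F) (degree p * d)"

lemma henon_map_imp_henon_degree: "henon_map H \<Longrightarrow> \<exists>d. henon_degree H d"
  by (induction rule: henon_map.induct) (blast intro: henon_degree.intros)+

lemma henon_degree_ge_2: "henon_degree H d \<Longrightarrow> 2 \<le> d"
proof (induction rule: henon_degree.induct)
  case (compose a p F d)
  then have "2 * 1 \<le> degree p * d" by (intro mult_mono) auto
  then show ?case by simp
qed

lemma henon_degree_deg_bounded: "henon_degree H d \<Longrightarrow> deg_bounded_map d H"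
proof (induction rule: henon_degree.induct)
  case (elementary a p)
  then show ?case using deg_bounded_map_elementary[OF deg_bounded_map_id] by fastforce
qed (rule deg_bounded_map_elementary)

section \<open>Cones and asymptotics at infinity\<close>

definition vert_cone :: "real \<Rightarrow> (complex \<times> complex) set" where
  "vert_cone R = {z. cmod (fst z) \<le> cmod (snd z) \<and> R \<le> cmod (snd z)}"

text \<open>The union of \<open>vert_cone R\<close> and the bidisc of radius \<open>R\<close>. Its
  complement |x| > max R |y| is the horizontal region of the usual filtration for Henon
  maps.\<close>

definition wide_cone :: "real \<Rightarrow> (complex \<times> complex) set" where
  "wide_cone R = {z. cmod (fst z) \<le> max R (cmod (snd z))}"

text \<open>This filter describes y tending to infinity within |x| <= |y|. It turns the asymptotics
  of a composition into a composition of limits.\<close>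

definition cone_filter :: "(complex \<times> complex) filter" where
  "cone_filter = inf (filtercomap (\<lambda>z. cmod (snd z)) at_top) (principal {z. cmod (fst z) \<le> cmod (snd z)})"

lemma eventually_cone_filter: "eventually P cone_filter \<longleftrightarrow> (\<exists>R. \<forall>z\<in>vert_cone R. P z)"
  unfolding cone_filter_def eventually_inf_principal eventually_filtercomap_at_top_linorder vert_cone_def
  by auto

lemma filterlim_snd_cone_filter: "filterlim snd at_infinity cone_filter"
proof -
  have "filterlim (\<lambda>z. cmod (snd z)) at_top cone_filter"
    unfolding filterlim_at_top eventually_cone_filter by (auto simp: vert_cone_def)
  then show ?thesis by (simp add: filterlim_at_infinity_conv_norm_at_top)
qed

lemma filterlim_cone_filterI:
  assumes "filterlim (\<lambda>z. snd (H z)) at_infinity F" "eventually (\<lambda>z. cmod (fst (H z)) \<le> cmod (snd (H z))) F"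
  shows "filterlim H cone_filter F"
  using assms unfolding cone_filter_def
  by (simp add: filterlim_inf filterlim_principal filterlim_filtercomap_iff filterlim_at_infinity_conv_norm_at_top o_def)

text \<open>Every clause survives composition, so estimates are needed for elementary maps only. In
  the last clause source and target share the same \<open>R\<close>, so it can be applied at every
  step of an orbit.\<close>

definition cone_map :: "nat \<Rightarrow> (complex \<times> complex \<Rightarrow> complex \<times> complex) \<Rightarrow> bool" where
  "cone_map d H \<longleftrightarrow>
     filterlim H cone_filter cone_filter \<and>
     (\<exists>c. c \<noteq> 0 \<and> ((\<lambda>z. snd (H z) / snd z ^ d) \<longlongrightarrow> c) cone_filter) \<and>
     (\<forall>\<^sub>F z in cone_filter. 2 * cmod (fst (H z)) \<le> cmod (snd (H z)) \<and> 2 * cmod (snd z) \<le> cmod (snd (H z))) \<and>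
     (\<forall>\<^sub>F R in at_top. \<forall>z. (z \<in> wide_cone R \<longrightarrow> H z \<in> wide_cone R) \<and>
        (H z \<notin> wide_cone R \<longrightarrow> 2 * sup_norm (H z) \<le> sup_norm z))"

text \<open>As the degree is at least 2, a x is negligible against y^d when |x| <= |y|, and p(y)
  governs the second coordinate. An image outside the wide cone has a small second coordinate, hence
  comes from cancellation between p(y) and a x, which forces |x| to be large.\<close>

lemma cone_map_elementary:
  assumes "a \<noteq> 0" "degree p \<ge> 2"
  shows "cone_map (degree p) (elementary_henon a p)"
proof -
  define d where "d = degree p"
  define H where "H = elementary_henon a p"
  have d: "d \<ge> 2" using assms by (simp add: d_def)
  have fst_H: "fst (H z) = snd z" and snd_H: "snd (H z) = poly p (snd z) - a * fst z" for z
    by (simp_all add: H_def elementary_henon_def case_prod_unfold)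
  have c: "lead_coeff p \<noteq> 0" using assms(2) by auto
  have inf_pow: "filterlim (\<lambda>x::complex. x ^ (d - 1)) at_infinity at_infinity"
    using d by (intro filterlim_power_at_infinity) auto
  have "((\<lambda>z. poly p (snd z) / snd z ^ d) \<longlongrightarrow> lead_coeff p) cone_filter"
    using filterlim_compose[OF poly_divide_tendsto_aux filterlim_snd_cone_filter] by (simp add: d_def)
  moreover have "((\<lambda>z. a * fst z / snd z ^ d) \<longlongrightarrow> 0) cone_filter"
  proof (rule Lim_null_comparison)
    show "((\<lambda>z. cmod (a / snd z ^ (d - 1))) \<longlongrightarrow> 0) cone_filter"
      by (intro tendsto_norm_zero tendsto_divide_0[OF tendsto_const]
          filterlim_compose[OF inf_pow filterlim_snd_cone_filter])
    have "cmod (a * fst z / snd z ^ d) \<le> cmod (a / snd z ^ (d - 1))" if "z \<in> vert_cone 1" for z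
    proof -
      have z: "cmod (fst z) \<le> cmod (snd z)" "snd z \<noteq> 0" using that by (auto simp: vert_cone_def)
      have "snd z ^ d = snd z * snd z ^ (d - 1)" using d by (cases d) auto
      then have "cmod (a * fst z / snd z ^ d) = cmod (a / snd z ^ (d - 1)) * (cmod (fst z) / cmod (snd z))"
        by (simp add: norm_mult norm_divide)
      also have "\<dots> \<le> cmod (a / snd z ^ (d - 1)) * 1"
        using z by (intro mult_left_mono) (auto simp: divide_le_eq)
      finally show ?thesis by simp
    qed
    then show "\<forall>\<^sub>F z in cone_filter. cmod (a * fst z / snd z ^ d) \<le> cmod (a / snd z ^ (d - 1))"
      unfolding eventually_cone_filter by blast
  qed
  ultimately have "((\<lambda>z. poly p (snd z) / snd z ^ d - a * fst z / snd z ^ d) \<longlongrightarrow> lead_coeff p - 0) cone_filter"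
    by (rule tendsto_diff)
  then have lim: "((\<lambda>z. snd (H z) / snd z ^ d) \<longlongrightarrow> lead_coeff p) cone_filter"
    by (simp add: snd_H diff_divide_distrib)
  have ne: "\<forall>\<^sub>F z in cone_filter. snd z \<noteq> 0"
    unfolding eventually_cone_filter by (intro exI[of _ 1]) (auto simp: vert_cone_def)
  have "filterlim (\<lambda>z. snd (H z) / snd z ^ d * snd z ^ (d - 1)) at_infinity cone_filter"
    by (rule tendsto_mult_filterlim_at_infinity[OF lim c filterlim_compose[OF inf_pow filterlim_snd_cone_filter]])
  then have "filterlim (\<lambda>z. snd (H z) / snd z) at_infinity cone_filter"
  proof (rule filterlim_cong[THEN iffD1, rotated -1])
    show "\<forall>\<^sub>F z in cone_filter. snd (H z) / snd z ^ d * snd z ^ (d - 1) = snd (H z) / snd z"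
      using ne by eventually_elim (use d in \<open>cases d; simp\<close>)
  qed auto
  then have "\<forall>\<^sub>F z in cone_filter. 2 \<le> cmod (snd (H z) / snd z)"
    unfolding filterlim_at_infinity_conv_norm_at_top filterlim_at_top by blast
  then have growth: "\<forall>\<^sub>F z in cone_filter. 2 * cmod (snd z) \<le> cmod (snd (H z))"
    using ne by eventually_elim (simp add: norm_divide field_simps)
  obtain R0 where R0: "\<And>z. z \<in> vert_cone R0 \<Longrightarrow> 2 * cmod (snd z) \<le> cmod (snd (H z))"
    using growth unfolding eventually_cone_filter by blast
  have "filterlim (\<lambda>y. poly p y / y) at_infinity at_infinity"
  proof (rule filterlim_cong[THEN iffD1, rotated -1])
    show "filterlim (\<lambda>y. poly p y / y ^ degree p * y ^ (d - 1)) at_infinity at_infinity"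
      by (rule tendsto_mult_filterlim_at_infinity[OF poly_divide_tendsto_aux c inf_pow])
    show "\<forall>\<^sub>F y in at_infinity. poly p y / y ^ degree p * y ^ (d - 1) = poly p y / y"
      using eventually_not_equal_at_infinity[of 0]
      by eventually_elim (use d in \<open>unfold d_def[symmetric], cases d; simp\<close>)
  qed auto
  \<comment> \<open>One |y| absorbs the second image coordinate, which is smaller than |y| when the
    image leaves the wide cone; what remains, 2 |a| |y| <= |a| |x|, supplies the factor 2.\<close>
  then have "\<forall>\<^sub>F y in at_infinity. 1 + 2 * cmod a \<le> cmod (poly p y / y)"
    unfolding filterlim_at_infinity_conv_norm_at_top filterlim_at_top by blast
  then obtain R1 where R1: "\<And>y. cmod y \<ge> R1 \<Longrightarrow> 1 + 2 * cmod a \<le> cmod (poly p y / y)"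
    unfolding eventually_at_infinity by blast
  have "(z \<in> wide_cone R \<longrightarrow> H z \<in> wide_cone R) \<and> (H z \<notin> wide_cone R \<longrightarrow> 2 * sup_norm (H z) \<le> sup_norm z)"
    if R: "R \<ge> max 1 (max R0 R1)" for R z
  proof (intro conjI impI)
    \<comment> \<open>If |y| <= R, the first image coordinate y is small enough. Otherwise
      \<open>z\<close> lies in \<open>vert_cone R0\<close> and the second image coordinate has
      modulus at least 2 |y|.\<close>
    assume "z \<in> wide_cone R"
    then show "H z \<in> wide_cone R"
      using R0[of z] R by (auto simp: wide_cone_def fst_H vert_cone_def max_def split: if_splits)
  next
    assume "H z \<notin> wide_cone R"
    then have y: "R < cmod (snd z)" and less: "cmod (snd (H z)) < cmod (snd z)"
      by (auto simp: wide_cone_def fst_H)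
    have "1 + 2 * cmod a \<le> cmod (poly p (snd z) / snd z)"
      using R1 y R by auto
    moreover have "0 < cmod (snd z)" using y R by linarith
    ultimately have "(1 + 2 * cmod a) * cmod (snd z) \<le> cmod (poly p (snd z))"
      by (simp add: norm_divide pos_le_divide_eq)
    moreover have "cmod (poly p (snd z)) \<le> cmod (snd (H z)) + cmod (a * fst z)"
      using norm_triangle_ineq[of "snd (H z)" "a * fst z"] by (simp add: snd_H)
    ultimately have "2 * cmod a * cmod (snd z) \<le> cmod a * cmod (fst z)"
      using less by (simp add: norm_mult algebra_simps)
    then have "2 * cmod (snd z) \<le> cmod (fst z)"
      using assms(1) by simp
    then show "2 * sup_norm (H z) \<le> sup_norm z"
      using less by (simp add: sup_norm_def fst_H)
  qed
  then have "\<forall>\<^sub>F R in at_top. \<forall>z. (z \<in> wide_cone R \<longrightarrow> H z \<in> wide_cone R) \<and>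
        (H z \<notin> wide_cone R \<longrightarrow> 2 * sup_norm (H z) \<le> sup_norm z)"
    unfolding eventually_at_top_linorder by blast
  moreover have "filterlim H cone_filter cone_filter"
  proof (rule filterlim_cone_filterI)
    show "filterlim (\<lambda>z. snd (H z)) at_infinity cone_filter"
      unfolding filterlim_at_infinity_conv_norm_at_top
    proof (rule filterlim_at_top_mono)
      show "filterlim (\<lambda>z. cmod (snd z)) at_top cone_filter"
        using filterlim_snd_cone_filter by (simp add: filterlim_at_infinity_conv_norm_at_top)
      show "\<forall>\<^sub>F z in cone_filter. cmod (snd z) \<le> cmod (snd (H z))"
        using growth by eventually_elim (smt (verit) norm_ge_zero)
    qed
    show "\<forall>\<^sub>F z in cone_filter. cmod (fst (H z)) \<le> cmod (snd (H z))"
      using growth by eventually_elim (smt (verit) norm_ge_zero fst_H)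
  qed
  ultimately show ?thesis
    using lim c growth unfolding cone_map_def H_def[symmetric] d_def[symmetric]
    by (auto simp: fst_H)
qed

lemma cone_map_compose:
  assumes H: "cone_map d H" and F: "cone_map e F"
  shows "cone_map (d * e) (H \<circ> F)"
proof -
  have limF: "filterlim F cone_filter cone_filter" using F by (simp add: cone_map_def)
  obtain c where c: "c \<noteq> 0" "((\<lambda>z. snd (H z) / snd z ^ d) \<longlongrightarrow> c) cone_filter"
    using H unfolding cone_map_def by blast
  obtain c' where c': "c' \<noteq> 0" "((\<lambda>z. snd (F z) / snd z ^ e) \<longlongrightarrow> c') cone_filter"
    using F unfolding cone_map_def by blast
  have "\<forall>\<^sub>F z in cone_filter. snd z \<noteq> 0"
    unfolding eventually_cone_filter by (intro exI[of _ 1]) (auto simp: vert_cone_def)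
  then have ne: "\<forall>\<^sub>F z in cone_filter. snd (F z) \<noteq> 0"
    using limF by (rule eventually_compose_filterlim)
  \<comment> \<open>The powers of \<open>snd (F z)\<close> cancel; the composite has leading
    coefficient \<open>c * c' ^ d\<close>.\<close>
  have "((\<lambda>z. snd (H (F z)) / snd (F z) ^ d * (snd (F z) / snd z ^ e) ^ d) \<longlongrightarrow> c * c' ^ d) cone_filter"
    by (intro tendsto_mult tendsto_power filterlim_compose[OF c(2) limF] c'(2))
  then have "((\<lambda>z. snd (H (F z)) / snd z ^ (d * e)) \<longlongrightarrow> c * c' ^ d) cone_filter"
  proof (rule Lim_transform_eventually)
    show "\<forall>\<^sub>F z in cone_filter. snd (H (F z)) / snd (F z) ^ d * (snd (F z) / snd z ^ e) ^ d = snd (H (F z)) / snd z ^ (d * e)"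
      using ne by eventually_elim (simp add: power_divide power_mult[symmetric] mult.commute)
  qed
  then have "\<exists>c. c \<noteq> 0 \<and> ((\<lambda>z. snd ((H \<circ> F) z) / snd z ^ (d * e)) \<longlongrightarrow> c) cone_filter"
    using c(1) c'(1) by (intro exI[of _ "c * c' ^ d"]) simp
  moreover have "filterlim (H \<circ> F) cone_filter cone_filter"
    using H limF filterlim_compose unfolding cone_map_def o_def by blast
  moreover have "\<forall>\<^sub>F z in cone_filter. 2 * cmod (fst ((H \<circ> F) z)) \<le> cmod (snd ((H \<circ> F) z)) \<and>
      2 * cmod (snd z) \<le> cmod (snd ((H \<circ> F) z))"
  proof -
    have "\<forall>\<^sub>F z in cone_filter. 2 * cmod (fst (H (F z))) \<le> cmod (snd (H (F z))) \<and>
        2 * cmod (snd (F z)) \<le> cmod (snd (H (F z)))"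
      using H unfolding cone_map_def by (intro eventually_compose_filterlim[OF _ limF]) blast
    moreover have "\<forall>\<^sub>F z in cone_filter. 2 * cmod (fst (F z)) \<le> cmod (snd (F z)) \<and>
        2 * cmod (snd z) \<le> cmod (snd (F z))"
      using F unfolding cone_map_def by blast
    ultimately show ?thesis
      by eventually_elim (smt (verit) norm_ge_zero comp_apply)
  qed
  moreover have "\<forall>\<^sub>F R in at_top. \<forall>z. (z \<in> wide_cone R \<longrightarrow> (H \<circ> F) z \<in> wide_cone R) \<and>
        ((H \<circ> F) z \<notin> wide_cone R \<longrightarrow> 2 * sup_norm ((H \<circ> F) z) \<le> sup_norm z)"
  proof -
    have nn: "sup_norm z \<ge> 0" for z by (simp add: sup_norm_def max_def)
    have "\<forall>\<^sub>F R in at_top. \<forall>z. (z \<in> wide_cone R \<longrightarrow> H z \<in> wide_cone R) \<and>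
        (H z \<notin> wide_cone R \<longrightarrow> 2 * sup_norm (H z) \<le> sup_norm z)"
      using H unfolding cone_map_def by blast
    moreover have "\<forall>\<^sub>F R in at_top. \<forall>z. (z \<in> wide_cone R \<longrightarrow> F z \<in> wide_cone R) \<and>
        (F z \<notin> wide_cone R \<longrightarrow> 2 * sup_norm (F z) \<le> sup_norm z)"
      using F unfolding cone_map_def by blast
    ultimately show ?thesis
    proof eventually_elim
      case (elim R)
      \<comment> \<open>If \<open>H (F z)\<close> is outside the wide cone, invariance under
        \<open>H\<close> puts \<open>F z\<close> outside as well, so both maps at least halve the
        norm.\<close>
      then show ?case
        unfolding comp_apply by (smt (verit) nn)
    qed
  qed
  ultimately show ?thesis
    unfolding cone_map_def by blast
qed

lemma henon_degree_cone_map: "henon_degree H d \<Longrightarrow> cone_map d H"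
  by (induction rule: henon_degree.induct) (blast intro: cone_map_elementary cone_map_compose)+

text \<open>The product of the degrees is an upper bound. It is sharp because the axis x = 0 lies in
  the cone, where the second component divided by y^d has a nonzero limit; a smaller degree would
  make this limit 0.\<close>

lemma poly_map_degree_eq:
  assumes "henon_degree H d"
  shows "poly_map_degree H = d"
  unfolding poly_map_degree_def
proof (rule Least_equality)
  show "poly_fun_deg_le d (\<lambda>z. fst (H z)) \<and> poly_fun_deg_le d (\<lambda>z. snd (H z))"
    using henon_degree_deg_bounded[OF assms] by (simp add: deg_bounded_map_def)
  fix n assume n: "poly_fun_deg_le n (\<lambda>z. fst (H z)) \<and> poly_fun_deg_le n (\<lambda>z. snd (H z))"
  show "d \<le> n"
  proof (rule ccontr)
    assume "\<not> d \<le> n"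
    obtain c where c: "(\<lambda>z. snd (H z)) = (\<lambda>z. \<Sum>i\<le>n. \<Sum>j\<le>n - i. c i j * fst z ^ i * snd z ^ j)"
      using n by (elim conjE poly_fun_deg_leE)
    \<comment> \<open>The factor \<open>0 ^ i\<close> is \<open>x ^ i\<close> at x = 0; since
      \<open>0 ^ 0 = 1\<close>, exactly the pure powers of y remain.\<close>
    define q where "q = (\<Sum>i\<le>n. \<Sum>j\<le>n - i. monom (c i j * 0 ^ i) j)"
    have "snd (H (0, y)) = poly q y" for y
      using fun_cong[OF c, of "(0, y)"] by (simp add: q_def poly_sum poly_monom)
    moreover have "degree q < degree (monom (1::complex) d)"
    proof -
      have "degree q \<le> n"
        unfolding q_def by (intro degree_sum_le order.trans[OF degree_monom_le]) auto
      then show ?thesis using \<open>\<not> d \<le> n\<close> by (simp add: degree_monom_eq)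
    qed
    ultimately have lim0: "((\<lambda>y. snd (H (0, y)) / y ^ d) \<longlongrightarrow> 0) at_infinity"
      using poly_divide_tendsto_0_at_infinity[of q "monom 1 d"] by (simp add: poly_monom)
    have fl: "filterlim (\<lambda>y. (0, y)) cone_filter at_infinity"
      by (rule filterlim_cone_filterI) (auto simp: filterlim_ident)
    obtain l where l: "l \<noteq> 0" "((\<lambda>z. snd (H z) / snd z ^ d) \<longlongrightarrow> l) cone_filter"
      using henon_degree_cone_map[OF assms] unfolding cone_map_def by blast
    have "((\<lambda>y. snd (H (0, y)) / y ^ d) \<longlongrightarrow> l) at_infinity"
      using filterlim_compose[OF l(2) fl] by (simp only: snd_conv)
    from tendsto_unique[OF _ this lim0] show False
      using l(1) by (simp add: trivial_limit_at_infinity)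
  qed
qed

section \<open>Inverses, restriction to lines, continuity\<close>

text \<open>\<open>henon_degree\<close> adds factors on the left, but inversion reverses their order
  and produces new factors on the right.\<close>

lemma henon_degree_elementary_right:
  assumes "henon_degree F d" "a \<noteq> 0" "degree p \<ge> 2"
  shows "henon_degree (F \<circ> elementary_henon a p) (d * degree p)"
  using assms(1)
proof (induction rule: henon_degree.induct)
  case (elementary b q)
  then show ?case
    using assms by (intro henon_degree.compose henon_degree.elementary)
next
  case (compose b q F d)
  from henon_degree.compose[OF compose.hyps(1,2) compose.IH] show ?case
    by (simp only: comp_assoc mult.assoc)
qed

text \<open>From (u, v) = (y, p(y) - a x) one recovers y = u and x = (p(u) - v) / a. The inverse has
  the two coordinates in exchanged roles, and the swap restores the elementary form.\<close>

lemma swap_inv_elementary_henon: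
  assumes "a \<noteq> 0"
  shows "bij (elementary_henon a p)"
    and "prod.swap \<circ> inv (elementary_henon a p) \<circ> prod.swap = elementary_henon (1 / a) (smult (1 / a) p)"
proof -
  let ?g = "\<lambda>(u, v). ((poly p u - v) / a, u)"
  have gf: "?g \<circ> elementary_henon a p = id" and fg: "elementary_henon a p \<circ> ?g = id"
    using assms by (auto simp: elementary_henon_def fun_eq_iff)
  show "bij (elementary_henon a p)"
    by (rule o_bij[OF gf fg])
  have "inv (elementary_henon a p) = ?g"
    by (rule inv_unique_comp[OF fg gf])
  then show "prod.swap \<circ> inv (elementary_henon a p) \<circ> prod.swap = elementary_henon (1 / a) (smult (1 / a) p)"
    by (auto simp: elementary_henon_def fun_eq_iff diff_divide_distrib)
qed

lemma henon_degree_swap_inv: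
  assumes "henon_degree H d"
  shows "bij H \<and> henon_degree (prod.swap \<circ> inv H \<circ> prod.swap) d"
  using assms
proof (induction rule: henon_degree.induct)
  case (elementary a p)
  then have "henon_degree (elementary_henon (1 / a) (smult (1 / a) p)) (degree (smult (1 / a) p))"
    by (intro henon_degree.elementary) auto
  then show ?case
    unfolding swap_inv_elementary_henon(2)[OF \<open>a \<noteq> 0\<close>]
    using swap_inv_elementary_henon(1)[OF \<open>a \<noteq> 0\<close>] \<open>a \<noteq> 0\<close> by simp
next
  case (compose a p F d)
  let ?E = "elementary_henon a p"
  have "henon_degree ((prod.swap \<circ> inv F \<circ> prod.swap) \<circ> elementary_henon (1 / a) (smult (1 / a) p))
      (d * degree (smult (1 / a) p))"
    by (rule henon_degree_elementary_right[OF compose.IH[THEN conjunct2]]) (use compose.hyps in simp_all)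
  moreover have "prod.swap \<circ> inv (?E \<circ> F) \<circ> prod.swap =
      (prod.swap \<circ> inv F \<circ> prod.swap) \<circ> elementary_henon (1 / a) (smult (1 / a) p)"
    unfolding swap_inv_elementary_henon(2)[OF \<open>a \<noteq> 0\<close>, symmetric]
    using compose.IH swap_inv_elementary_henon(1)[OF \<open>a \<noteq> 0\<close>]
    by (auto simp: o_inv_distrib fun_eq_iff)
  moreover have "degree (smult (1 / a) p) = degree p"
    using compose.hyps(1) by simp
  moreover have "bij (?E \<circ> F)"
    using compose.IH swap_inv_elementary_henon(1)[OF \<open>a \<noteq> 0\<close>] by (blast intro: bij_comp)
  ultimately show ?case
    by (metis mult.commute)
qed

text \<open>Stable under composition by its form. Applied to lines, it makes each iterate a pair of
  one-variable polynomials, as needed both for Jensen's inequality and for holomorphy.\<close>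

definition polynomial_on_curves :: "(complex \<times> complex \<Rightarrow> complex \<times> complex) \<Rightarrow> bool" where
  "polynomial_on_curves H \<longleftrightarrow> (\<forall>p q. \<exists>p' q'. \<forall>\<zeta>. H (poly p \<zeta>, poly q \<zeta>) = (poly p' \<zeta>, poly q' \<zeta>))"

lemma polynomial_on_curves_id: "polynomial_on_curves id"
  by (auto simp: polynomial_on_curves_def)

lemma polynomial_on_curves_compose:
  "polynomial_on_curves H \<Longrightarrow> polynomial_on_curves F \<Longrightarrow> polynomial_on_curves (H \<circ> F)"
  unfolding polynomial_on_curves_def comp_apply by metis

lemma polynomial_on_curves_elementary: "polynomial_on_curves (elementary_henon a p)"
  unfolding polynomial_on_curves_def
proof (intro allI)
  fix q r
  show "\<exists>p' q'. \<forall>\<zeta>. elementary_henon a p (poly q \<zeta>, poly r \<zeta>) = (poly p' \<zeta>, poly q' \<zeta>)"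
    by (rule exI[of _ r], rule exI[of _ "pcompose p r - smult a q"])
       (simp add: elementary_henon_def poly_pcompose)
qed

lemma henon_degree_polynomial_on_curves: "henon_degree H d \<Longrightarrow> polynomial_on_curves H"
  by (induction rule: henon_degree.induct)
     (blast intro: polynomial_on_curves_elementary polynomial_on_curves_compose)+

lemma continuous_on_henon_degree: "henon_degree H d \<Longrightarrow> continuous_on UNIV H"
proof (induction rule: henon_degree.induct)
  case (elementary a p)
  show ?case
    unfolding elementary_henon_def case_prod_unfold by (intro continuous_intros)
next
  case (compose a p F d)
  have "continuous_on (range F) (elementary_henon a p)"
    unfolding elementary_henon_def case_prod_unfold by (intro continuous_intros)
  with compose.IH show ?case by (rule continuous_on_compose)
qed

section \<open>The Green function of a sequence of Henon maps\<close>

lemma sup_norm_nonneg: "0 \<le> sup_norm z"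
  by (simp add: sup_norm_def max_def)

lemma sup_norm_le_norm: "sup_norm z \<le> norm z"
  using norm_fst_le[of "fst z" "snd z"] norm_snd_le[of "snd z" "fst z"] by (simp add: sup_norm_def)

lemma norm_le_sup_norm: "norm z \<le> 2 * sup_norm z"
  using norm_Pair_le[of "fst z" "snd z"] by (simp add: sup_norm_def max_def)

lemma continuous_on_sup_norm [continuous_intros]:
  "continuous_on S f \<Longrightarrow> continuous_on S (\<lambda>x. sup_norm (f x))"
  unfolding sup_norm_def by (intro continuous_intros)

lemma sup_norm_swap [simp]: "sup_norm (prod.swap z) = sup_norm z"
  by (simp add: sup_norm_def max.commute)

lemma sup_norm_vert_cone: "z \<in> vert_cone R \<Longrightarrow> sup_norm z = cmod (snd z)"
  by (simp add: vert_cone_def sup_norm_def)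

lemma log_plus_sup_norm_vert_cone:
  assumes "z \<in> vert_cone R" "1 \<le> R"
  shows "log_plus (sup_norm z) = ln (cmod (snd z))"
proof -
  have "1 \<le> cmod (snd z)" using assms by (simp add: vert_cone_def)
  then show ?thesis by (simp add: sup_norm_vert_cone[OF assms(1)] log_plus_def)
qed

lemma not_wide_cone: "z \<notin> wide_cone R \<Longrightarrow> R < sup_norm z"
  by (auto simp: wide_cone_def sup_norm_def)

lemma wide_cone_cases: "z \<in> wide_cone R \<Longrightarrow> z \<in> vert_cone R \<or> sup_norm z \<le> R"
  by (auto simp: wide_cone_def vert_cone_def sup_norm_def max_def split: if_splits)

section \<open>Quantitative estimates for a single map\<close>

text \<open>\<open>cone_map\<close> at an explicit radius. The tolerance 1/2 keeps the quotient in a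
  closed disc on which the principal logarithm is holomorphic and bounded.\<close>

definition cone_step :: "(complex \<times> complex \<Rightarrow> complex \<times> complex) \<Rightarrow> nat \<Rightarrow> complex \<Rightarrow> real \<Rightarrow> bool" where
  "cone_step H d c R \<longleftrightarrow>
     (\<forall>z\<in>vert_cone R. 2 * cmod (fst (H z)) \<le> cmod (snd (H z)) \<and> 2 * cmod (snd z) \<le> cmod (snd (H z)) \<and>
        cmod (snd (H z) / (c * snd z ^ d) - 1) \<le> 1/2) \<and>
     (\<forall>z\<in>wide_cone R. H z \<in> wide_cone R) \<and>
     (\<forall>z. H z \<notin> wide_cone R \<longrightarrow> 2 * sup_norm (H z) \<le> sup_norm z)"

lemma cone_stepD:
  assumes "cone_step H d c R"
  shows "z \<in> vert_cone R \<Longrightarrow> 2 * cmod (fst (H z)) \<le> cmod (snd (H z))"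
    and "z \<in> vert_cone R \<Longrightarrow> 2 * cmod (snd z) \<le> cmod (snd (H z))"
    and "z \<in> vert_cone R \<Longrightarrow> cmod (snd (H z) / (c * snd z ^ d) - 1) \<le> 1/2"
    and "z \<in> wide_cone R \<Longrightarrow> H z \<in> wide_cone R"
    and "H z \<notin> wide_cone R \<Longrightarrow> 2 * sup_norm (H z) \<le> sup_norm z"
  using assms[unfolded cone_step_def, THEN conjunct1, THEN bspec, of z]
    assms[unfolded cone_step_def, THEN conjunct2, THEN conjunct1, THEN bspec, of z]
    assms[unfolded cone_step_def, THEN conjunct2, THEN conjunct2, THEN spec, of z]
  by simp_all

lemma cone_step_vert_cone:
  assumes "cone_step H d c R" "0 \<le> R" "z \<in> vert_cone R"
  shows "H z \<in> vert_cone R"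
  using cone_stepD(1,2)[OF assms(1,3)] assms(2,3) by (auto simp: vert_cone_def intro: order.trans[rotated])

lemma polynomial_on_curves_line:
  assumes "polynomial_on_curves H"
  obtains p q where "\<And>\<zeta>. H (complex_line a b \<zeta>) = (poly p \<zeta>, poly q \<zeta>)"
proof -
  from assms[unfolded polynomial_on_curves_def, THEN spec, of "[:fst a, fst b:]", THEN spec, of "[:snd a, snd b:]"]
  obtain p q where "\<forall>\<zeta>. H (poly [:fst a, fst b:] \<zeta>, poly [:snd a, snd b:] \<zeta>) = (poly p \<zeta>, poly q \<zeta>)"
    by (elim exE)
  then show ?thesis
    by (intro that[of p q]) (simp add: complex_line_def)
qed

text \<open>The coefficient \<open>c\<close> is fixed first and then every large \<open>R\<close> is
  admissible, so finitely many maps can share one radius.\<close>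

lemma cone_map_imp_cone_step:
  assumes "cone_map d H"
  shows "\<exists>c. c \<noteq> 0 \<and> (\<forall>\<^sub>F R in at_top. cone_step H d c R)"
proof -
  obtain c where c: "c \<noteq> 0" "((\<lambda>z. snd (H z) / snd z ^ d) \<longlongrightarrow> c) cone_filter"
    using assms unfolding cone_map_def by blast
  have "((\<lambda>z. snd (H z) / snd z ^ d / c) \<longlongrightarrow> c / c) cone_filter"
    by (intro tendsto_divide c tendsto_const)
  then have "((\<lambda>z. snd (H z) / (c * snd z ^ d)) \<longlongrightarrow> 1) cone_filter"
    using c(1) by (simp add: mult.commute)
  from tendstoD[OF this, of "1/2"]
  have "\<forall>\<^sub>F z in cone_filter. cmod (snd (H z) / (c * snd z ^ d) - 1) < 1/2"
    by (simp add: dist_norm)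
  moreover have "\<forall>\<^sub>F z in cone_filter. 2 * cmod (fst (H z)) \<le> cmod (snd (H z)) \<and> 2 * cmod (snd z) \<le> cmod (snd (H z))"
    using assms unfolding cone_map_def by blast
  ultimately have "\<forall>\<^sub>F z in cone_filter. 2 * cmod (fst (H z)) \<le> cmod (snd (H z)) \<and>
      2 * cmod (snd z) \<le> cmod (snd (H z)) \<and> cmod (snd (H z) / (c * snd z ^ d) - 1) \<le> 1/2"
    by eventually_elim simp
  then obtain R0 where R0: "\<forall>z\<in>vert_cone R0. 2 * cmod (fst (H z)) \<le> cmod (snd (H z)) \<and>
      2 * cmod (snd z) \<le> cmod (snd (H z)) \<and> cmod (snd (H z) / (c * snd z ^ d) - 1) \<le> 1/2"
    unfolding eventually_cone_filter ..
  have cone_mono: "vert_cone R \<subseteq> vert_cone R0" if "R0 \<le> R" for R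
    using that by (auto simp: vert_cone_def)
  have "\<forall>\<^sub>F R in at_top. \<forall>z. (z \<in> wide_cone R \<longrightarrow> H z \<in> wide_cone R) \<and>
        (H z \<notin> wide_cone R \<longrightarrow> 2 * sup_norm (H z) \<le> sup_norm z)"
    using assms unfolding cone_map_def by blast
  with eventually_ge_at_top[of R0] have "\<forall>\<^sub>F R in at_top. cone_step H d c R"
  proof eventually_elim
    case (elim R)
    show ?case
      unfolding cone_step_def
    proof (intro conjI)
      show "\<forall>z\<in>vert_cone R. 2 * cmod (fst (H z)) \<le> cmod (snd (H z)) \<and> 2 * cmod (snd z) \<le> cmod (snd (H z)) \<and>
          cmod (snd (H z) / (c * snd z ^ d) - 1) \<le> 1/2"
        by (rule ballI, rule bspec[OF R0]) (use cone_mono[OF elim(1)] in blast)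
      show "\<forall>z\<in>wide_cone R. H z \<in> wide_cone R"
        by (rule ballI) (rule elim(2)[THEN spec, THEN conjunct1, THEN mp])
      show "\<forall>z. H z \<notin> wide_cone R \<longrightarrow> 2 * sup_norm (H z) \<le> sup_norm z"
        by (rule allI) (rule elim(2)[THEN spec, THEN conjunct2])
    qed
  qed
  with c(1) show ?thesis by blast
qed

text \<open>The bound on ln |c| is included because this number appears in the terms of the
  logarithmic series. The property persists when \<open>M\<close> grows, so finitely many maps can
  share one \<open>M\<close>.\<close>

definition log_growth_bound :: "(complex \<times> complex \<Rightarrow> complex \<times> complex) \<Rightarrow> nat \<Rightarrow> complex \<Rightarrow> real \<Rightarrow> real \<Rightarrow> bool" where
  "log_growth_bound H d c R M \<longleftrightarrow> \<bar>ln (cmod c)\<bar> \<le> M \<and>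
     (\<forall>z\<in>wide_cone R. \<bar>log_plus (sup_norm (H z)) - real d * log_plus (sup_norm z)\<bar> \<le> M)"

lemma ln_snd_cone_step:
  assumes step: "cone_step H d c R" and "c \<noteq> 0" "1 \<le> R" and z: "z \<in> vert_cone R"
  shows "Re (Ln (snd (H z) / (c * snd z ^ d))) = ln (cmod (snd (H z))) - ln (cmod c) - real d * ln (cmod (snd z))"
proof -
  have "1 \<le> cmod (snd z)" using z \<open>1 \<le> R\<close> by (simp add: vert_cone_def)
  moreover from this have "1 \<le> cmod (snd (H z))"
    using cone_stepD(2)[OF step z] by linarith
  ultimately have "0 < cmod (snd z)" "0 < cmod (snd (H z))" by linarith+
  with \<open>c \<noteq> 0\<close> show ?thesis
    by (simp add: norm_divide norm_mult norm_power ln_div ln_mult ln_realpow)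
qed

lemma Re_pos_half_disc: "cmod (w - 1) \<le> 1/2 \<Longrightarrow> 0 < Re w"
  using abs_Re_le_cmod[of "w - 1"] by simp

lemma Ln_bounded_half_disc: "\<exists>L. \<forall>w. cmod (w - 1) \<le> 1/2 \<longrightarrow> cmod (Ln w) \<le> L"
proof -
  have "continuous_on (cball 1 (1/2)) Ln"
  proof (intro continuous_on_Ln continuous_on_id)
    fix w :: complex assume "w \<in> cball 1 (1/2)"
    then have "0 < Re w" by (intro Re_pos_half_disc) (simp add: dist_norm norm_minus_commute)
    then show "w \<notin> \<real>\<^sub>\<le>\<^sub>0" by (auto simp: complex_nonpos_Reals_iff)
  qed
  then have "bounded (Ln ` cball 1 (1/2))"
    by (intro compact_imp_bounded compact_continuous_image) auto
  then obtain L where "\<forall>w\<in>cball 1 (1/2). cmod (Ln w) \<le> L"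
    unfolding bounded_iff by blast
  then show ?thesis
    by (intro exI[of _ L]) (simp add: dist_norm norm_minus_commute)
qed

text \<open>On \<open>vert_cone R\<close> the error is ln |c| plus the real part of a bounded
  logarithm. The rest of the wide cone lies in the bidisc of radius \<open>R\<close>, where
  compactness bounds both logarithms.\<close>

lemma cone_step_imp_log_growth_bound:
  assumes step: "cone_step H d c R" and c: "c \<noteq> 0" and R: "1 \<le> R" and cont: "continuous_on UNIV H"
  shows "\<exists>M. log_growth_bound H d c R M"
proof -
  obtain L where L: "\<And>w. cmod (w - 1) \<le> 1/2 \<Longrightarrow> cmod (Ln w) \<le> L"
    using Ln_bounded_half_disc by blast
  let ?S = "{z. sup_norm z \<le> R}"
  have "bounded ?S"
    unfolding bounded_iff
  proof (intro exI[of _ "2 * R"] ballI)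
    fix z assume "z \<in> ?S"
    then show "norm z \<le> 2 * R" using norm_le_sup_norm[of z] by simp
  qed
  moreover have "closed ?S"
    by (intro closed_Collect_le continuous_intros)
  ultimately have "compact (H ` ?S)"
    by (intro compact_continuous_image continuous_on_subset[OF cont]) (auto simp: compact_eq_bounded_closed)
  from compact_imp_bounded[OF this] obtain B where "\<forall>w\<in>H ` ?S. norm w \<le> B"
    unfolding bounded_iff ..
  then have B: "norm (H z) \<le> B" if "z \<in> ?S" for z
    using imageI[OF that] by (rule bspec)
  define M where "M = max (L + \<bar>ln (cmod c)\<bar>) (log_plus B + real d * log_plus R)"
  have "\<bar>log_plus (sup_norm (H z)) - real d * log_plus (sup_norm z)\<bar> \<le> M" if z: "z \<in> wide_cone R" for z
  proof (cases "z \<in> vert_cone R")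
    case True
    let ?q = "snd (H z) / (c * snd z ^ d)"
    have "z \<in> vert_cone R" "H z \<in> vert_cone R" "cmod (?q - 1) \<le> 1/2"
      using cone_stepD(3)[OF step True] cone_step_vert_cone[OF step _ True] R True by simp_all
    then have eq: "log_plus (sup_norm (H z)) - real d * log_plus (sup_norm z) =
        ln (cmod (snd (H z))) - real d * ln (cmod (snd z))"
      using R by (simp add: log_plus_sup_norm_vert_cone)
    have "\<bar>Re (Ln ?q)\<bar> \<le> L"
      using abs_Re_le_cmod[of "Ln ?q"] L[OF \<open>cmod (?q - 1) \<le> 1/2\<close>] by linarith
    then have "\<bar>ln (cmod (snd (H z))) - ln (cmod c) - real d * ln (cmod (snd z))\<bar> \<le> L"
      unfolding ln_snd_cone_step[OF step c R True] .
    then show ?thesis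
      unfolding eq M_def by linarith
  next
    case False
    then have z: "sup_norm z \<le> R" using that wide_cone_cases by blast
    then have "sup_norm (H z) \<le> B"
      using B[of z] sup_norm_le_norm[of "H z"] by simp
    then have "log_plus (sup_norm (H z)) \<le> log_plus B"
      by (intro log_plus_mono sup_norm_nonneg)
    moreover have "real d * log_plus (sup_norm z) \<le> real d * log_plus R"
      using z by (intro mult_left_mono log_plus_mono sup_norm_nonneg) simp_all
    moreover have "0 \<le> log_plus (sup_norm (H z))" "0 \<le> real d * log_plus (sup_norm z)" "0 \<le> log_plus B"
      "0 \<le> real d * log_plus R"
      by (simp_all add: log_plus_nonneg)
    ultimately show ?thesis unfolding M_def by linarith
  qed
  moreover have "\<bar>ln (cmod c)\<bar> \<le> M"
  proof -
    have "0 \<le> L" using L[of 1] by simp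
    then show ?thesis by (simp add: M_def)
  qed
  ultimately show ?thesis
    unfolding log_growth_bound_def by blast
qed

section \<open>Orbits and convergence of the normalised logarithms\<close>

text \<open>\<open>R\<close> and \<open>M\<close> are independent of \<open>k\<close>: this is what
  a finite collection provides. The conditions start at k = 1, the first index that
  \<open>comp_seq\<close> reads.\<close>

locale cone_sequence =
  fixes h :: "nat \<Rightarrow> complex \<times> complex \<Rightarrow> complex \<times> complex" and c :: "nat \<Rightarrow> complex" and R M :: real
  assumes R: "1 \<le> R"
    and henon: "k \<ge> 1 \<Longrightarrow> henon_degree (h k) (poly_map_degree (h k))"
    and c: "k \<ge> 1 \<Longrightarrow> c k \<noteq> 0"
    and cone_step: "k \<ge> 1 \<Longrightarrow> cone_step (h k) (poly_map_degree (h k)) (c k) R"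
    and growth: "k \<ge> 1 \<Longrightarrow> log_growth_bound (h k) (poly_map_degree (h k)) (c k) R M"
begin

abbreviation "iter \<equiv> forward_iter h"
abbreviation "deg k \<equiv> poly_map_degree (h k)"

lemma M_nonneg: "0 \<le> M"
  using growth[of 1] by (auto simp: log_growth_bound_def)

lemma deg_prod_Suc: "deg_prod h (Suc k) = deg_prod h k * deg (Suc k)"
  by (simp add: deg_prod_def)

lemma deg_prod_ge: "2 ^ k \<le> real (deg_prod h k)"
proof (induction k)
  case (Suc k)
  have "2 \<le> real (deg (Suc k))"
    using henon_degree_ge_2[OF henon[of "Suc k"]] by simp
  with Suc show ?case
    unfolding deg_prod_Suc by (simp add: mult_mono mult.commute[of 2])
qed (simp add: deg_prod_def)

lemma deg_prod_pos: "0 < real (deg_prod h k)"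
  using deg_prod_ge[of k] by (smt (verit) zero_less_power)

lemma inverse_deg_prod_le: "1 / real (deg_prod h k) \<le> (1/2) ^ k"
  using deg_prod_ge[of k] by (simp add: power_one_over divide_left_mono frac_le)

lemma continuous_on_iter: "continuous_on UNIV (iter k)"
proof (induction k)
  case (Suc k)
  have "continuous_on (range (iter k)) (h (Suc k))"
    using continuous_on_henon_degree[OF henon[of "Suc k"]] continuous_on_subset by force
  with Suc show ?case
    unfolding comp_seq.simps by (intro continuous_on_compose)
qed (simp add: id_def)

lemma polynomial_on_curves_iter: "polynomial_on_curves (iter k)"
proof (induction k)
  case (Suc k)
  then show ?case
    unfolding comp_seq.simps
    by (intro polynomial_on_curves_compose henon_degree_polynomial_on_curves[OF henon]) simp_all
qed (use polynomial_on_curves_id in \<open>simp add: id_def\<close>)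

lemma iter_Suc: "iter (Suc k) z = h (Suc k) (iter k z)"
  by simp

lemma iter_wide_cone_mono:
  assumes "iter k z \<in> wide_cone R" "k \<le> l" shows "iter l z \<in> wide_cone R"
  using assms(2,1)
proof (induction l rule: dec_induct)
  case (step l)
  then show ?case
    unfolding iter_Suc by (intro cone_stepD(4)[OF cone_step]) simp_all
qed

text \<open>Were the k-th iterate outside, invariance would put all earlier ones outside too. Then k
  halvings bring the norm down to at most \<open>R\<close>, whereas points outside the wide cone
  have norm above \<open>R\<close>.\<close>

lemma iter_wide_cone:
  assumes "sup_norm z \<le> 2 ^ k * R" shows "iter k z \<in> wide_cone R"
proof (rule ccontr)
  assume "iter k z \<notin> wide_cone R"
  moreover have "2 ^ k * sup_norm (iter k z) \<le> sup_norm z" if "iter k z \<notin> wide_cone R"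
    using that
  proof (induction k)
    case (Suc k)
    have "iter k z \<notin> wide_cone R"
      using Suc.prems iter_wide_cone_mono[of k z "Suc k"] by (auto simp del: comp_seq.simps)
    have "2 * sup_norm (iter (Suc k) z) \<le> sup_norm (iter k z)"
      using Suc.prems unfolding iter_Suc by (intro cone_stepD(5)[OF cone_step]) simp_all
    then have "2 ^ k * (2 * sup_norm (iter (Suc k) z)) \<le> 2 ^ k * sup_norm (iter k z)"
      by (intro mult_left_mono) simp_all
    also have "\<dots> \<le> sup_norm z"
      by (rule Suc.IH) fact
    finally show ?case by (simp only: power_Suc mult_ac)
  qed simp
  moreover have "2 ^ k * R < 2 ^ k * sup_norm (iter k z)" if "iter k z \<notin> wide_cone R"
    using not_wide_cone[OF that] by simp
  ultimately show False using assms by fastforce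
qed

lemma G_plus_eq: "G_plus h k z = log_plus (sup_norm (iter k z)) / real (deg_prod h k)"
  by (simp add: G_plus_def)

lemma G_plus_nonneg: "0 \<le> G_plus h k z"
  by (simp add: G_plus_eq log_plus_nonneg)

text \<open>After division by d_(k+1) = d_k deg h_(k+1) the main terms cancel, leaving M /
  d_(k+1).\<close>

lemma G_plus_step:
  assumes "iter k z \<in> wide_cone R"
  shows "\<bar>G_plus h (Suc k) z - G_plus h k z\<bar> \<le> M * (1/2) ^ Suc k"
proof -
  have "\<bar>log_plus (sup_norm (iter (Suc k) z)) - real (deg (Suc k)) * log_plus (sup_norm (iter k z))\<bar> \<le> M"
    using growth[of "Suc k"] assms unfolding log_growth_bound_def iter_Suc by simp
  moreover have "G_plus h (Suc k) z - G_plus h k z =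
     (log_plus (sup_norm (iter (Suc k) z)) - real (deg (Suc k)) * log_plus (sup_norm (iter k z))) / real (deg_prod h (Suc k))"
    using deg_prod_pos[of k] henon_degree_ge_2[OF henon[of "Suc k"]] unfolding G_plus_eq deg_prod_Suc
    by (simp add: diff_divide_distrib del: comp_seq.simps)
  ultimately have "\<bar>G_plus h (Suc k) z - G_plus h k z\<bar> \<le> M * (1 / real (deg_prod h (Suc k)))"
    using deg_prod_pos[of "Suc k"] by (simp add: divide_right_mono)
  also have "\<dots> \<le> M * (1/2) ^ Suc k"
    by (intro mult_left_mono inverse_deg_prod_le M_nonneg)
  finally show ?thesis .
qed

text \<open>The step errors form a geometric series; keeping its exact partial sum makes the
  induction close.\<close>

lemma G_plus_diff:
  assumes "iter k z \<in> wide_cone R" "k \<le> l"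
  shows "\<bar>G_plus h l z - G_plus h k z\<bar> \<le> M * ((1/2) ^ k - (1/2) ^ l)"
  using assms(2)
proof (induction l rule: dec_induct)
  case (step l)
  have "\<bar>G_plus h (Suc l) z - G_plus h l z\<bar> \<le> M * (1/2) ^ Suc l"
    by (intro G_plus_step iter_wide_cone_mono[OF assms(1)] step)
  moreover have "M * (1/2) ^ Suc l = M * (1/2) ^ l / 2" by simp
  ultimately show ?case
    using step.IH unfolding right_diff_distrib by linarith
qed simp

definition Green :: "complex \<times> complex \<Rightarrow> real" where
  "Green z = lim (\<lambda>k. G_plus h k z)"

lemma ex_radius: "\<exists>k. r \<le> 2 ^ k * R"
proof -
  obtain k where "r < 2 ^ k" using real_arch_pow[of 2 r] by auto
  moreover have "(2::real) ^ k \<le> 2 ^ k * R" using R by simp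
  ultimately show ?thesis by (intro exI[of _ k]) linarith
qed

lemma G_plus_diff_le:
  assumes "iter k z \<in> wide_cone R" "k \<le> l"
  shows "\<bar>G_plus h l z - G_plus h k z\<bar> \<le> M * (1/2) ^ k"
proof -
  have "M * ((1/2) ^ k - (1/2) ^ l) \<le> M * (1/2) ^ k"
    by (intro mult_left_mono M_nonneg) simp
  then show ?thesis using G_plus_diff[OF assms] by linarith
qed

lemma M_half_powers: "(\<lambda>k. M * (1/2) ^ k) \<longlonglongrightarrow> 0"
  by (intro tendsto_mult_right_zero LIMSEQ_power_zero) simp

lemma G_plus_tendsto: "(\<lambda>k. G_plus h k z) \<longlonglongrightarrow> Green z"
proof -
  obtain K where K: "sup_norm z \<le> 2 ^ K * R" using ex_radius by blast
  have "Cauchy (\<lambda>k. G_plus h k z)"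
  proof (rule CauchyI')
    fix e :: real assume "e > 0"
    then have "\<forall>\<^sub>F k in sequentially. M * (1/2) ^ k < e"
      using M_half_powers order_tendstoD(2) by blast
    then obtain N where N: "\<And>k. k \<ge> N \<Longrightarrow> M * (1/2) ^ k < e"
      unfolding eventually_sequentially by blast
    show "\<exists>N. \<forall>m\<ge>N. \<forall>n>m. dist (G_plus h m z) (G_plus h n z) < e"
    proof (intro exI[of _ "max N K"] allI impI)
      fix m n assume mn: "max N K \<le> m" "m < n"
      have "iter m z \<in> wide_cone R"
        by (rule iter_wide_cone_mono[OF iter_wide_cone[OF K]]) (use mn in simp)
      then have "\<bar>G_plus h n z - G_plus h m z\<bar> \<le> M * (1/2) ^ m"
        by (rule G_plus_diff_le) (use mn in simp)
      also have "\<dots> < e" by (rule N) (use mn in simp)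
      finally show "dist (G_plus h m z) (G_plus h n z) < e" by (simp add: dist_real_def abs_minus_commute)
    qed
  qed
  then show ?thesis
    unfolding Green_def by (simp add: Cauchy_convergent convergent_LIMSEQ_iff[symmetric])
qed

lemma Green_nonneg: "0 \<le> Green z"
  using LIMSEQ_le_const[OF G_plus_tendsto] G_plus_nonneg by blast

lemma Green_diff:
  assumes "iter k z \<in> wide_cone R"
  shows "\<bar>G_plus h k z - Green z\<bar> \<le> M * (1/2) ^ k"
proof (rule LIMSEQ_le_const2)
  show "(\<lambda>l. \<bar>G_plus h k z - G_plus h l z\<bar>) \<longlonglongrightarrow> \<bar>G_plus h k z - Green z\<bar>"
    by (intro tendsto_intros G_plus_tendsto)
  show "\<exists>N. \<forall>l\<ge>N. \<bar>G_plus h k z - G_plus h l z\<bar> \<le> M * (1/2) ^ k"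
    using G_plus_diff_le[OF assms] by (intro exI[of _ k]) (simp add: abs_minus_commute)
qed

lemma uniform_limit_Green: "uniform_limit {z. sup_norm z \<le> r} (G_plus h) Green sequentially"
proof (rule uniform_limitI)
  fix e :: real assume "e > 0"
  then have "\<forall>\<^sub>F k in sequentially. M * (1/2) ^ k < e"
    using M_half_powers order_tendstoD(2) by blast
  obtain K where K: "r \<le> 2 ^ K * R" using ex_radius by blast
  from \<open>\<forall>\<^sub>F k in sequentially. M * (1/2) ^ k < e\<close> eventually_ge_at_top[of K]
  show "\<forall>\<^sub>F k in sequentially. \<forall>z\<in>{z. sup_norm z \<le> r}. dist (G_plus h k z) (Green z) < e"
  proof eventually_elim
    case (elim k)
    show ?case
    proof
      fix z assume "z \<in> {z. sup_norm z \<le> r}"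
      then have "iter K z \<in> wide_cone R"
        using K by (intro iter_wide_cone) simp
      then have "\<bar>G_plus h k z - Green z\<bar> \<le> M * (1/2) ^ k"
        by (intro Green_diff iter_wide_cone_mono[OF _ elim(2)])
      then show "dist (G_plus h k z) (Green z) < e" using elim(1) by (simp add: dist_real_def)
    qed
  qed
qed

lemma continuous_on_G_plus: "continuous_on S (G_plus h k)"
proof -
  have "continuous_on UNIV (\<lambda>z. log_plus (sup_norm (iter k z)) / real (deg_prod h k))"
    using deg_prod_pos[of k] continuous_on_iter by (intro continuous_intros sup_norm_nonneg) auto
  then have "continuous_on UNIV (G_plus h k)"
    by (rule continuous_on_eq) (simp add: G_plus_eq)
  then show ?thesis using continuous_on_subset by blast
qed

lemma continuous_on_Green: "continuous_on UNIV Green"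
proof (rule continuous_at_imp_continuous_on, rule ballI)
  fix z
  have "continuous_on {w. sup_norm w \<le> sup_norm z + 1} Green"
    by (rule uniform_limit_theorem[OF _ uniform_limit_Green]) (auto intro!: always_eventually continuous_on_G_plus)
  then have "continuous_on {w. sup_norm w < sup_norm z + 1} Green"
    by (rule continuous_on_subset) auto
  moreover have "open {w. sup_norm w < sup_norm z + 1}"
    by (intro open_Collect_less continuous_intros)
  ultimately have "\<forall>w\<in>{w. sup_norm w < sup_norm z + 1}. isCont Green w"
    using continuous_on_eq_continuous_at by blast
  from bspec[OF this, of z] show "isCont Green z" by simp
qed

section \<open>Sub-mean value property and vanishing on bounded orbits\<close>

text \<open>At the centre the maximum is attained by one of the two polynomials. Jensen's inequality
  for that one suffices, since the logarithm of the maximum dominates it on the circle.\<close>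

lemma G_plus_submean:
  "2 * pi * G_plus h k a \<le> integral {0..2*pi} (\<lambda>t. G_plus h k (complex_line a b (cis t)))"
proof -
  obtain p q where pq: "\<And>\<zeta>. iter k (complex_line a b \<zeta>) = (poly p \<zeta>, poly q \<zeta>)"
    using polynomial_on_curves_line[OF polynomial_on_curves_iter] by blast
  let ?I = "integral {0..2*pi} (\<lambda>t. log_plus (sup_norm (iter k (complex_line a b (cis t)))))"
  have int: "(\<lambda>t. log_plus (sup_norm (iter k (complex_line a b (cis t))))) integrable_on {0..2*pi}"
    unfolding pq sup_norm_def fst_conv snd_conv
    by (intro integrable_continuous_real continuous_intros) (simp add: max_def)
  have le: "2 * pi * log_plus (cmod (poly r 0)) \<le> ?I" if r: "r = p \<or> r = q" for r
  proof -
    have "2 * pi * log_plus (cmod (poly r 0)) \<le> integral {0..2*pi} (\<lambda>t. log_plus (cmod (poly r (cis t))))"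
      by (rule log_plus_poly_submean)
    also have "\<dots> \<le> ?I"
    proof (rule integral_le[OF _ int])
      show "(\<lambda>t. log_plus (cmod (poly r (cis t)))) integrable_on {0..2*pi}"
        by (intro integrable_continuous_real continuous_intros norm_ge_zero)
      show "log_plus (cmod (poly r (cis t))) \<le> log_plus (sup_norm (iter k (complex_line a b (cis t))))" for t
        using r unfolding pq sup_norm_def by (intro log_plus_mono) auto
    qed
    finally show ?thesis .
  qed
  have "2 * pi * log_plus (sup_norm (iter k a)) \<le> ?I"
    using le[of p] le[of q] pq[of 0] by (auto simp: sup_norm_def max_def)
  then have "2 * pi * log_plus (sup_norm (iter k a)) / real (deg_prod h k) \<le> ?I / real (deg_prod h k)"
    by (intro divide_right_mono) simp_all
  then show ?thesis
    by (simp add: G_plus_eq)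
qed

text \<open>The circle has bounded sup norm, so convergence on it is uniform and the integrals
  converge.\<close>

lemma Green_submean: "2 * pi * Green a \<le> integral {0..2*pi} (\<lambda>t. Green (complex_line a b (cis t)))"
proof -
  have "continuous_on {0..2*pi} (\<lambda>t. sup_norm (complex_line a b (cis t)))"
    by (intro continuous_intros)
  then have "bounded ((\<lambda>t. sup_norm (complex_line a b (cis t))) ` {0..2*pi})"
    by (intro compact_imp_bounded compact_continuous_image) auto
  then obtain r where *: "\<forall>x\<in>(\<lambda>t. sup_norm (complex_line a b (cis t))) ` {0..2*pi}. norm x \<le> r"
    unfolding bounded_iff by blast
  have r: "sup_norm (complex_line a b (cis t)) \<le> r" if "t \<in> {0..2*pi}" for t
    using bspec[OF * imageI[OF that]] by simp
  have ul: "uniform_limit {0..2*pi} (\<lambda>k t. G_plus h k (complex_line a b (cis t)))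
      (\<lambda>t. Green (complex_line a b (cis t))) sequentially"
    by (rule uniform_limit_compose'[OF uniform_limit_Green[of r]]) (use r in auto)
  have cont: "continuous_on {0..2*pi} (\<lambda>t. G_plus h k (complex_line a b (cis t)))" for k
    by (rule continuous_on_compose2[OF continuous_on_G_plus[of UNIV]]) (auto intro!: continuous_intros)
  from uniform_limit_integral[OF ul cont] obtain I J where IJ:
    "\<And>k. ((\<lambda>t. G_plus h k (complex_line a b (cis t))) has_integral I k) {0..2*pi}"
    "((\<lambda>t. Green (complex_line a b (cis t))) has_integral J) {0..2*pi}" "I \<longlonglongrightarrow> J"
    by auto
  have "2 * pi * Green a \<le> J"
  proof (rule LIMSEQ_le)
    show "(\<lambda>k. 2 * pi * G_plus h k a) \<longlonglongrightarrow> 2 * pi * Green a"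
      by (intro tendsto_intros G_plus_tendsto)
    show "\<exists>N. \<forall>k\<ge>N. 2 * pi * G_plus h k a \<le> I k"
      using G_plus_submean[of _ a b] integral_unique[OF IJ(1)] by auto
  qed (rule IJ(3))
  then show ?thesis
    using integral_unique[OF IJ(2)] by simp
qed

lemma Green_eq_0:
  assumes "z \<in> K_plus h" shows "Green z = 0"
proof -
  from assms have "bounded ((\<lambda>k. iter k z) ` {1..})"
    by (simp add: K_plus_def bounded_set_def)
  then obtain B where *: "\<forall>w\<in>(\<lambda>k. iter k z) ` {1..}. norm w \<le> B"
    unfolding bounded_iff ..
  have B: "norm (iter k z) \<le> B" if "k \<ge> 1" for k
    using bspec[OF * imageI[of k]] that by simp
  have "(\<lambda>k. G_plus h k z) \<longlonglongrightarrow> 0"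
  proof (rule Lim_null_comparison)
    show "(\<lambda>k. log_plus B * (1/2) ^ k) \<longlonglongrightarrow> 0"
      by (intro tendsto_mult_right_zero LIMSEQ_power_zero) simp
    have "norm (G_plus h k z) \<le> log_plus B * (1/2) ^ k" if "k \<ge> 1" for k
    proof -
      have "sup_norm (iter k z) \<le> B"
        using B[OF that] sup_norm_le_norm[of "iter k z"] by linarith
      then have "log_plus (sup_norm (iter k z)) * (1 / real (deg_prod h k)) \<le> log_plus B * (1/2) ^ k"
        by (intro mult_mono log_plus_mono sup_norm_nonneg inverse_deg_prod_le log_plus_nonneg) simp_all
      then show ?thesis using G_plus_nonneg[of k z] by (simp add: G_plus_eq)
    qed
    then show "\<forall>\<^sub>F k in sequentially. norm (G_plus h k z) \<le> log_plus B * (1/2) ^ k"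
      unfolding eventually_sequentially by blast
  qed
  then show ?thesis using G_plus_tendsto LIMSEQ_unique by blast
qed

section \<open>Escaping points and the logarithmic series\<close>

lemma iter_vert_cone:
  assumes "iter k z \<in> vert_cone R"
  shows "iter (k + n) z \<in> vert_cone R \<and> 2 ^ n * R \<le> cmod (snd (iter (k + n) z))"
proof (induction n)
  case 0
  then show ?case using assms by (simp add: vert_cone_def)
next
  case (Suc n)
  have step: "cone_step (h (Suc (k + n))) (deg (Suc (k + n))) (c (Suc (k + n))) R"
    by (rule cone_step) simp
  have "2 ^ Suc n * R \<le> 2 * cmod (snd (iter (k + n) z))"
    using Suc by simp
  also have "\<dots> \<le> cmod (snd (iter (Suc (k + n)) z))"
    unfolding iter_Suc by (rule cone_stepD(2)[OF step]) (use Suc in simp)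
  finally have "2 ^ Suc n * R \<le> cmod (snd (iter (Suc (k + n)) z))" .
  moreover have "iter (Suc (k + n)) z \<in> vert_cone R"
    unfolding iter_Suc by (rule cone_step_vert_cone[OF step]) (use Suc R in simp_all)
  ultimately show ?case by (simp only: add_Suc_right simp_thms)
qed

text \<open>Strict inequalities make each region open, and the regions exhaust
  \<open>U_plus h\<close>.\<close>

definition escape_region :: "nat \<Rightarrow> (complex \<times> complex) set" where
  "escape_region k = {z. cmod (fst (iter k z)) < cmod (snd (iter k z)) \<and> R < cmod (snd (iter k z))}"

lemma open_escape_region: "open (escape_region k)"
  unfolding escape_region_def
  by (intro open_Collect_conj open_Collect_less continuous_intros continuous_on_iter)

lemma escape_region_vert_cone: "z \<in> escape_region k \<Longrightarrow> iter k z \<in> vert_cone R"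
  by (simp add: escape_region_def vert_cone_def)

lemma escape_region_subset: "escape_region k \<subseteq> U_plus h"
proof
  fix z assume "z \<in> escape_region k"
  then have cone: "iter k z \<in> vert_cone R" by (rule escape_region_vert_cone)
  have "filterlim (\<lambda>n. norm (iter (n + k) z)) at_top sequentially"
  proof (rule filterlim_at_top_mono)
    show "filterlim (\<lambda>n. (2::real) ^ n) at_top sequentially"
      by real_asymp
    show "\<forall>\<^sub>F n in sequentially. 2 ^ n \<le> norm (iter (n + k) z)"
    proof (rule always_eventually, rule allI)
      fix n
      have "2 ^ n * 1 \<le> 2 ^ n * R" using R by (intro mult_left_mono) simp_all
      also have "\<dots> \<le> cmod (snd (iter (k + n) z))"
        using iter_vert_cone[OF cone] by blast
      also have "\<dots> \<le> sup_norm (iter (k + n) z)" by (simp add: sup_norm_def)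
      also have "\<dots> \<le> norm (iter (k + n) z)" by (rule sup_norm_le_norm)
      finally show "2 ^ n \<le> norm (iter (n + k) z)" by (simp add: add.commute)
    qed
  qed
  then have "filterlim (\<lambda>n. norm (iter n z)) at_top sequentially"
    unfolding filterlim_iff using eventually_sequentially_seg[of "\<lambda>n. P (norm (iter n z))" k for P] by simp
  then show "z \<in> U_plus h"
    by (simp add: U_plus_def escaping_set_def filterlim_at_infinity_conv_norm_at_top)
qed

lemma U_plus_imp_escape_region:
  assumes "z \<in> U_plus h" shows "\<exists>k. z \<in> escape_region k"
proof -
  have "filterlim (\<lambda>n. norm (iter n z)) at_top sequentially"
    using assms by (simp add: U_plus_def escaping_set_def filterlim_at_infinity_conv_norm_at_top)
  \<comment> \<open>The product norm is at most twice the sup norm, so 2 R here forces a sup norm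
    above \<open>R\<close>.\<close>
  then have "\<forall>\<^sub>F n in sequentially. 2 * R < norm (iter n z)"
    by (simp add: filterlim_at_top_dense)
  then obtain N where N: "\<And>n. n \<ge> N \<Longrightarrow> 2 * R < norm (iter n z)"
    unfolding eventually_sequentially by blast
  obtain K where K: "sup_norm z \<le> 2 ^ K * R" using ex_radius by blast
  let ?k = "max N K"
  have "iter ?k z \<in> wide_cone R"
    by (rule iter_wide_cone_mono[OF iter_wide_cone[OF K]]) simp
  moreover have "R < sup_norm (iter ?k z)"
    using N[of ?k] norm_le_sup_norm[of "iter ?k z"] by simp
  ultimately have cone: "iter ?k z \<in> vert_cone R"
    using wide_cone_cases by fastforce
  \<comment> \<open>One more step makes the inequalities strict: the second coordinate grows to at
    least 2 R > R and is at least twice the first.\<close>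
  have step: "cone_step (h (Suc ?k)) (deg (Suc ?k)) (c (Suc ?k)) R"
    by (rule cone_step) simp
  have "R \<le> cmod (snd (iter ?k z))" using cone by (simp add: vert_cone_def)
  then have "z \<in> escape_region (Suc ?k)"
    using cone_stepD(1,2)[OF step cone] R unfolding escape_region_def iter_Suc
    by (simp only: mem_Collect_eq) (smt (verit) norm_ge_zero)
  then show ?thesis ..
qed

lemma line_holo_snd_iter: "line_holo UNIV (\<lambda>z. snd (iter k z))"
  unfolding line_holo_def
proof (intro conjI allI)
  show "continuous_on UNIV (\<lambda>z. snd (iter k z))"
    by (intro continuous_intros continuous_on_iter)
  fix a b
  obtain p q where "\<And>\<zeta>. iter k (complex_line a b \<zeta>) = (poly p \<zeta>, poly q \<zeta>)"
    using polynomial_on_curves_line[OF polynomial_on_curves_iter] by blast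
  then show "(\<lambda>\<zeta>. snd (iter k (complex_line a b \<zeta>))) holomorphic_on {\<zeta>. complex_line a b \<zeta> \<in> UNIV}"
    by (simp add: holomorphic_intros)
qed

text \<open>The multiplicative error of one step against the model y -> c y^d.\<close>

definition ratio :: "nat \<Rightarrow> complex \<times> complex \<Rightarrow> complex" where
  "ratio k z = snd (iter (Suc k) z) / (c (Suc k) * snd (iter k z) ^ deg (Suc k))"

lemma ratio_half_disc:
  assumes "iter k z \<in> vert_cone R" shows "cmod (ratio k z - 1) \<le> 1/2"
  unfolding ratio_def iter_Suc by (rule cone_stepD(3)[OF cone_step assms]) simp

lemma G_plus_vert_cone:
  assumes "iter k z \<in> vert_cone R"
  shows "G_plus h k z = ln (cmod (snd (iter k z))) / real (deg_prod h k)"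
  by (simp add: G_plus_eq log_plus_sup_norm_vert_cone[OF assms R])

text \<open>Take ln of the modulus in the definition of \<open>ratio\<close> and divide by d_(k+1).
  The correction is the real part of one term of the series.\<close>

lemma G_plus_Suc_vert_cone:
  assumes "iter k z \<in> vert_cone R"
  shows "G_plus h (Suc k) z = G_plus h k z + (Re (Ln (ratio k z)) + ln (cmod (c (Suc k)))) / real (deg_prod h (Suc k))"
proof -
  have step: "cone_step (h (Suc k)) (deg (Suc k)) (c (Suc k)) R" by (rule cone_step) simp
  have "iter (Suc k) z \<in> vert_cone R"
    using iter_vert_cone[OF assms, of 1] by simp
  then have "G_plus h (Suc k) z = ln (cmod (snd (iter (Suc k) z))) / real (deg_prod h (Suc k))"
    by (rule G_plus_vert_cone)
  moreover have "Re (Ln (ratio k z)) + ln (cmod (c (Suc k))) =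
      ln (cmod (snd (iter (Suc k) z))) - real (deg (Suc k)) * ln (cmod (snd (iter k z)))"
    unfolding ratio_def iter_Suc by (subst ln_snd_cone_step[OF step c R assms]) simp_all
  ultimately show ?thesis
    using deg_prod_pos[of k] henon_degree_ge_2[OF henon[of "Suc k"]] G_plus_vert_cone[OF assms]
    unfolding deg_prod_Suc by (simp add: diff_divide_distrib del: comp_seq.simps)
qed

lemma line_holo_Ln_ratio:
  assumes "W \<subseteq> {z. iter k z \<in> vert_cone R}"
  shows "line_holo W (\<lambda>z. Ln (ratio k z))"
proof (rule line_holo_compose[where f = "ratio k" and g = Ln and T = "{w. 0 < Re w}"])
  have y: "line_holo W (\<lambda>z. snd (iter j z))" for j
    by (rule line_holo_subset[OF line_holo_snd_iter]) simp
  have "line_holo W (\<lambda>z. 1 / (c (Suc k) * snd (iter k z) ^ deg (Suc k)))"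
  proof (rule line_holo_compose[OF y, where g = "\<lambda>w. 1 / (c (Suc k) * w ^ deg (Suc k))" and T = "- {0}"])
    show "(\<lambda>w. 1 / (c (Suc k) * w ^ deg (Suc k))) holomorphic_on - {0}"
      using c[of "Suc k"] by (intro holomorphic_intros) auto
    show "snd (iter k z) \<in> - {0}" if "z \<in> W" for z
      using assms that R by (auto simp: vert_cone_def)
  qed
  from line_holo_mult[OF y this, of "Suc k"] show "line_holo W (ratio k)"
    unfolding ratio_def by simp
  show "Ln holomorphic_on {w. 0 < Re w}"
    by (intro holomorphic_on_Ln) (auto simp: complex_nonpos_Reals_iff)
  show "ratio k z \<in> {w. 0 < Re w}" if "z \<in> W" for z
    using Re_pos_half_disc[OF ratio_half_disc] assms that by blast
qed

lemma locally_Re_holo_Green: "locally_Re_holo (U_plus h) Green"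
  unfolding locally_Re_holo_def
proof (rule ballI)
  fix z0 assume "z0 \<in> U_plus h"
  then obtain K where K: "z0 \<in> escape_region K" using U_plus_imp_escape_region by blast
  let ?y = "\<lambda>k z. snd (iter k z)"
  have y0: "?y K z0 \<noteq> 0" using K R by (auto simp: escape_region_def)
  \<comment> \<open>The second condition keeps y_K / y_K(z0) within 1/2 of 1, where the principal
    logarithm is holomorphic.\<close>
  let ?W = "escape_region K \<inter> {z. cmod (?y K z / ?y K z0 - 1) < 1/2}"
  have W: "open ?W"
    using y0 by (intro open_Int open_escape_region open_Collect_less continuous_intros continuous_on_iter) auto
  have W_cone: "iter (K + n) z \<in> vert_cone R" if "z \<in> ?W" for n z
    using iter_vert_cone[OF escape_region_vert_cone] that by blast
  obtain L where L: "\<And>w. cmod (w - 1) \<le> 1/2 \<Longrightarrow> cmod (Ln w) \<le> L"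
    using Ln_bounded_half_disc by blast
  \<comment> \<open>Adding the real constant ln |y_K(z0)| makes the real part ln |y_K| without
    choosing an argument for y_K(z0).\<close>
  define \<Phi>0 where "\<Phi>0 z = (Ln (?y K z / ?y K z0) + of_real (ln (cmod (?y K z0)))) * of_real (1 / real (deg_prod h K))" for z
  define t where "t n z = (Ln (ratio (K + n) z) + of_real (ln (cmod (c (Suc (K + n)))))) *
      of_real (1 / real (deg_prod h (Suc (K + n))))" for n z
  define \<Phi> where "\<Phi> z = \<Phi>0 z + (\<Sum>n. t n z)" for z
  have "line_holo ?W (\<lambda>z. Ln (?y K z / ?y K z0))"
  proof (rule line_holo_compose
      [where T = "{w. 0 < Re (w / ?y K z0)}" and f = "?y K" and g = "\<lambda>w. Ln (w / ?y K z0)"])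
    show "line_holo ?W (?y K)" by (rule line_holo_subset[OF line_holo_snd_iter]) simp
    show "(\<lambda>w. Ln (w / ?y K z0)) holomorphic_on {w. 0 < Re (w / ?y K z0)}"
      using y0 by (intro holomorphic_intros) (auto simp: complex_nonpos_Reals_iff)
    show "?y K z \<in> {w. 0 < Re (w / ?y K z0)}" if "z \<in> ?W" for z
      using Re_pos_half_disc[of "?y K z / ?y K z0"] that by simp
  qed
  then have \<Phi>0: "line_holo ?W \<Phi>0"
    unfolding \<Phi>0_def by (intro line_holo_mult line_holo_add line_holo_const)
  have t: "line_holo ?W (t n)" for n
    unfolding t_def
    by (intro line_holo_mult line_holo_add line_holo_const line_holo_Ln_ratio) (use W_cone in blast)
  \<comment> \<open>\<open>L\<close> bounds the logarithm of the quotient and \<open>M\<close>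
    bounds ln |c|; the weight 1 / d_(K+n+1) is at most 2^-(K+n+1), hence at most 2^-n.\<close>
  have t_bound: "norm (t n z) \<le> (L + M) * (1/2) ^ n" if "z \<in> ?W" for n z
  proof -
    have "norm (Ln (ratio (K + n) z) + of_real (ln (cmod (c (Suc (K + n)))))) \<le> L + M"
    proof (rule order.trans[OF norm_triangle_ineq add_mono])
      show "norm (Ln (ratio (K + n) z)) \<le> L"
        by (rule L[OF ratio_half_disc[OF W_cone[OF that]]])
      show "norm (complex_of_real (ln (cmod (c (Suc (K + n)))))) \<le> M"
        using growth[of "Suc (K + n)"] by (simp add: log_growth_bound_def)
    qed
    moreover have "norm (complex_of_real (1 / real (deg_prod h (Suc (K + n))))) \<le> (1/2) ^ n"
    proof -
      have "1 / real (deg_prod h (Suc (K + n))) \<le> (1/2) ^ Suc (K + n)" by (rule inverse_deg_prod_le)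
      also have "\<dots> \<le> (1/2) ^ n" by (rule power_decreasing) simp_all
      finally show ?thesis unfolding norm_of_real by simp
    qed
    moreover have "0 \<le> L + M"
      using L[of 1] M_nonneg by simp
    ultimately show ?thesis
      unfolding t_def norm_mult by (intro mult_mono) simp_all
  qed
  have ul: "uniform_limit ?W (\<lambda>n z. \<Sum>i<n. t i z) (\<lambda>z. \<Sum>n. t n z) sequentially"
    by (rule Weierstrass_m_test[OF t_bound]) (auto intro!: summable_mult summable_geometric)
  have "line_holo ?W (\<lambda>z. \<Sum>n. t n z)"
    by (rule line_holo_uniform_limit[OF W line_holo_sum ul]) (rule t)
  then have "line_holo ?W \<Phi>"
    unfolding \<Phi>_def by (rule line_holo_add[OF \<Phi>0])
  moreover have "Green z = Re (\<Phi> z)" if "z \<in> ?W" for z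
  proof -
    \<comment> \<open>The sum telescopes: the real parts of the partial sums are the approximants
      themselves, which identifies the limit with \<open>Green\<close>.\<close>
    have G: "G_plus h (K + n) z = Re (\<Phi>0 z + (\<Sum>i<n. t i z))" for n
    proof (induction n)
      case 0
      have "?y K z \<noteq> 0" using W_cone[OF that, of 0] R by (auto simp: vert_cone_def)
      then have "Re (Ln (?y K z / ?y K z0)) = ln (cmod (?y K z)) - ln (cmod (?y K z0))"
        using y0 by (simp add: norm_divide ln_div)
      then show ?case
        using G_plus_vert_cone[OF W_cone[OF that, of 0]] by (simp add: \<Phi>0_def)
    next
      case (Suc n)
      have "Re (t n z) = (Re (Ln (ratio (K + n) z)) + ln (cmod (c (Suc (K + n))))) / real (deg_prod h (Suc (K + n)))"
        by (simp add: t_def)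
      then show ?case
        using G_plus_Suc_vert_cone[OF W_cone[OF that, of n]] Suc by simp
    qed
    have "(\<lambda>n. \<Sum>i<n. t i z) \<longlonglongrightarrow> (\<Sum>n. t n z)"
      by (rule tendsto_uniform_limitI[OF ul that])
    then have "(\<lambda>n. Re (\<Phi>0 z + (\<Sum>i<n. t i z))) \<longlonglongrightarrow> Re (\<Phi> z)"
      unfolding \<Phi>_def by (intro tendsto_intros)
    moreover have "(\<lambda>n. G_plus h (n + K) z) \<longlonglongrightarrow> Green z"
      by (rule LIMSEQ_ignore_initial_segment[OF G_plus_tendsto])
    ultimately show ?thesis
      unfolding G[symmetric] add.commute[of K] using LIMSEQ_unique by blast
  qed
  moreover have "z0 \<in> ?W" using K y0 by simp
  moreover have "?W \<subseteq> U_plus h" using escape_region_subset by blast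
  ultimately show "\<exists>W F. open W \<and> z0 \<in> W \<and> W \<subseteq> U_plus h \<and> line_holo W F \<and> (\<forall>w\<in>W. Green w = Re (F w))"
    using W by (intro exI[of _ ?W] exI[of _ \<Phi>] conjI ballI) simp_all
qed

end

section \<open>Common constants and reduction of the backward case\<close>

text \<open>The constants are chosen in the order \<open>c\<close>, \<open>R\<close>,
  \<open>M\<close>, each depending on the earlier ones. Finiteness makes \<open>R\<close> and
  \<open>M\<close> common to all maps; \<open>c\<close> may differ from map to map.\<close>

lemma forward_Green_function:
  assumes "finite \<G>" "\<forall>H\<in>\<G>. \<exists>d. henon_degree H d" "\<forall>k\<ge>1. h k \<in> \<G>"
  obtains G where "\<And>z. (\<lambda>k. G_plus h k z) \<longlonglongrightarrow> G z" "continuous_on UNIV G" "\<And>z. 0 \<le> G z"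
    "\<And>a b. 2 * pi * G a \<le> integral {0..2*pi} (\<lambda>t. G (complex_line a b (cis t)))"
    "locally_Re_holo (U_plus h) G" "\<And>z. z \<in> K_plus h \<Longrightarrow> G z = 0"
proof -
  have deg: "henon_degree H (poly_map_degree H)" if "H \<in> \<G>" for H
    using assms(2) that poly_map_degree_eq by blast
  have "\<forall>H\<in>\<G>. \<exists>c. c \<noteq> 0 \<and> (\<forall>\<^sub>F R in at_top. cone_step H (poly_map_degree H) c R)"
    using deg henon_degree_cone_map cone_map_imp_cone_step by blast
  from bchoice[OF this] obtain c where
    c: "\<forall>H\<in>\<G>. c H \<noteq> 0 \<and> (\<forall>\<^sub>F R in at_top. cone_step H (poly_map_degree H) (c H) R)" ..
  have "\<forall>\<^sub>F R in at_top. \<forall>H\<in>\<G>. cone_step H (poly_map_degree H) (c H) R"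
    by (rule eventually_ball_finite[OF \<open>finite \<G>\<close>]) (use c in blast)
  from eventually_conj[OF this eventually_ge_at_top[of 1]]
  obtain R where R: "1 \<le> R" "\<And>H. H \<in> \<G> \<Longrightarrow> cone_step H (poly_map_degree H) (c H) R"
    unfolding eventually_at_top_linorder by blast
  have "\<forall>H\<in>\<G>. \<forall>\<^sub>F M in at_top. log_growth_bound H (poly_map_degree H) (c H) R M"
  proof
    fix H assume H: "H \<in> \<G>"
    obtain M where M: "log_growth_bound H (poly_map_degree H) (c H) R M"
      using cone_step_imp_log_growth_bound[OF R(2)[OF H] _ R(1) continuous_on_henon_degree[OF deg[OF H]]] c H by blast
    show "\<forall>\<^sub>F M in at_top. log_growth_bound H (poly_map_degree H) (c H) R M"
      using eventually_ge_at_top[of M]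
      by eventually_elim (use M in \<open>auto simp: log_growth_bound_def intro: order.trans\<close>)
  qed
  then have "\<forall>\<^sub>F M in at_top. \<forall>H\<in>\<G>. log_growth_bound H (poly_map_degree H) (c H) R M"
    by (rule eventually_ball_finite[OF \<open>finite \<G>\<close>])
  then obtain M where M: "\<And>H. H \<in> \<G> \<Longrightarrow> log_growth_bound H (poly_map_degree H) (c H) R M"
    unfolding eventually_at_top_linorder by blast
  interpret cone_sequence h "\<lambda>k. c (h k)" R M
    by unfold_locales (use assms(3) R M deg c in auto)
  show ?thesis
    by (rule that[OF G_plus_tendsto continuous_on_Green Green_nonneg Green_submean locally_Re_holo_Green Green_eq_0])
qed

lemma line_holo_swap:
  assumes "line_holo W F" shows "line_holo (prod.swap -` W) (\<lambda>z. F (prod.swap z))"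
  unfolding line_holo_def
proof (intro conjI allI)
  show "continuous_on (prod.swap -` W) (\<lambda>z. F (prod.swap z))"
    by (rule continuous_on_compose2[OF line_holoD(1)[OF assms]]) (auto intro!: continuous_intros)
  show "(\<lambda>\<zeta>. F (prod.swap (complex_line a b \<zeta>))) holomorphic_on {\<zeta>. complex_line a b \<zeta> \<in> prod.swap -` W}" for a b
    using line_holoD(2)[OF assms, of "prod.swap a" "prod.swap b"] by (simp add: complex_line_def)
qed

lemma open_vimage_swap: "open W \<Longrightarrow> open (prod.swap -` W)"
  by (rule open_vimage) (auto intro!: continuous_intros)

lemma locally_Re_holo_swap:
  assumes "locally_Re_holo \<Omega> u" shows "locally_Re_holo (prod.swap -` \<Omega>) (\<lambda>z. u (prod.swap z))"
  unfolding locally_Re_holo_def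
proof
  fix z assume "z \<in> prod.swap -` \<Omega>"
  then have "prod.swap z \<in> \<Omega>" by simp
  obtain W F where W: "open W" "prod.swap z \<in> W" "W \<subseteq> \<Omega>" "line_holo W F" "\<And>w. w \<in> W \<Longrightarrow> u w = Re (F w)"
    by (rule locally_Re_holoE[OF assms \<open>prod.swap z \<in> \<Omega>\<close>]) blast
  show "\<exists>W F. open W \<and> z \<in> W \<and> W \<subseteq> prod.swap -` \<Omega> \<and> line_holo W F \<and> (\<forall>w\<in>W. u (prod.swap w) = Re (F w))"
    by (intro exI[of _ "prod.swap -` W"] exI[of _ "\<lambda>z. F (prod.swap z)"] conjI ballI
        open_vimage_swap line_holo_swap vimage_mono W) (use W in simp_all)
qed

lemma pluriharmonic_on_zero:
  assumes "open \<Omega>" "\<And>z. z \<in> \<Omega> \<Longrightarrow> u z = 0" shows "pluriharmonic_on \<Omega> u"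
proof (rule locally_Re_holo_imp_pluriharmonic_on)
  show "locally_Re_holo \<Omega> u"
    unfolding locally_Re_holo_def
    by (intro ballI exI[of _ \<Omega>] exI[of _ "\<lambda>_. 0"] conjI line_holo_const) (use assms in simp_all)
qed

lemma norm_swap [simp]: "norm (prod.swap z :: complex \<times> complex) = norm z"
  by (cases z) (simp add: norm_Pair add.commute)

theorem theorem6p2:
  fixes \<G> :: "(complex \<times> complex \<Rightarrow> complex \<times> complex) set"
    and h :: "nat \<Rightarrow> complex \<times> complex \<Rightarrow> complex \<times> complex"
  assumes "finite \<G>" and "\<G> \<noteq> {}"
    and "\<And>H. H \<in> \<G> \<Longrightarrow> henon_map H"
    and "\<And>k. k \<ge> 1 \<Longrightarrow> h k \<in> \<G>"
  shows "\<exists>Gp Gm :: complex \<times> complex \<Rightarrow> real.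
     (\<forall>z. (\<lambda>k. G_plus h k z) \<longlonglongrightarrow> Gp z) \<and>
     (\<forall>z. (\<lambda>k. G_minus h k z) \<longlonglongrightarrow> Gm z) \<and>
     continuous_on UNIV Gp \<and> plurisubharmonic_on UNIV (\<lambda>z. ereal (Gp z)) \<and>
     continuous_on UNIV Gm \<and> plurisubharmonic_on UNIV (\<lambda>z. ereal (Gm z)) \<and>
     pluriharmonic_on (U_plus h) Gp \<and> pluriharmonic_on (interior (K_plus h)) Gp \<and>
     pluriharmonic_on (U_minus h) Gm \<and> pluriharmonic_on (interior (K_minus h)) Gm"
proof -
  have deg: "\<forall>H\<in>\<G>. \<exists>d. henon_degree H d"
    using assms(3) henon_map_imp_henon_degree by blast
  \<comment> \<open>Inverses grow in the first coordinate instead of the second; conjugation by the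
    swap exchanges the two.\<close>
  define \<sigma> where "\<sigma> H = prod.swap \<circ> inv H \<circ> prod.swap" for H :: "complex \<times> complex \<Rightarrow> complex \<times> complex"
  define h' where "h' k = \<sigma> (h k)" for k
  have deg': "\<forall>H\<in>\<sigma> ` \<G>. \<exists>d. henon_degree H d"
    using deg henon_degree_swap_inv unfolding \<sigma>_def by blast
  have mem: "\<forall>k\<ge>1. h k \<in> \<G>" and mem': "\<forall>k\<ge>1. h' k \<in> \<sigma> ` \<G>"
    using assms(4) by (simp_all add: h'_def)
  obtain Gp where Gp: "\<And>z. (\<lambda>k. G_plus h k z) \<longlonglongrightarrow> Gp z" "continuous_on UNIV Gp" "\<And>z. 0 \<le> Gp z"
    "\<And>a b. 2 * pi * Gp a \<le> integral {0..2*pi} (\<lambda>t. Gp (complex_line a b (cis t)))"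
    "locally_Re_holo (U_plus h) Gp" "\<And>z. z \<in> K_plus h \<Longrightarrow> Gp z = 0"
    by (rule forward_Green_function[OF assms(1) deg mem]) blast
  obtain G' where G': "\<And>z. (\<lambda>k. G_plus h' k z) \<longlonglongrightarrow> G' z" "continuous_on UNIV G'" "\<And>z. 0 \<le> G' z"
    "\<And>a b. 2 * pi * G' a \<le> integral {0..2*pi} (\<lambda>t. G' (complex_line a b (cis t)))"
    "locally_Re_holo (U_plus h') G'" "\<And>z. z \<in> K_plus h' \<Longrightarrow> G' z = 0"
    by (rule forward_Green_function[OF finite_imageI[OF assms(1)] deg' mem']) blast
  define Gm where "Gm z = G' (prod.swap z)" for z
  have deg_eq: "poly_map_degree (h' k) = poly_map_degree (h k)" if "k \<ge> 1" for k
  proof -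
    obtain d where d: "henon_degree (h k) d" using deg mem \<open>k \<ge> 1\<close> by blast
    then have "henon_degree (h' k) d"
      using henon_degree_swap_inv[OF d] unfolding h'_def \<sigma>_def by blast
    with d show ?thesis by (simp add: poly_map_degree_eq)
  qed
  \<comment> \<open>The inner swaps cancel. \<open>backward_iter\<close> applies the inverses in the
    order of the indices, so the conjugated sequence needs no reversal.\<close>
  have iter: "forward_iter h' k (prod.swap z) = prod.swap (backward_iter h k z)" for k z
  proof (induction k)
    case (Suc k)
    have "h' (Suc k) w = prod.swap (inv (h (Suc k)) (prod.swap w))" for w
      by (simp add: h'_def \<sigma>_def)
    with Suc show ?case by simp
  qed simp
  have "deg_prod h' k = deg_prod h k" for k
    unfolding deg_prod_def by (intro prod.cong refl deg_eq) simp
  then have G_minus: "G_minus h k z = G_plus h' k (prod.swap z)" for k z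
    by (simp add: G_minus_def G_plus_def iter)
  have U: "U_minus h = prod.swap -` U_plus h'"
    unfolding U_minus_def U_plus_def escaping_set_def
    by (intro set_eqI) (simp only: vimage_def mem_Collect_eq iter filterlim_at_infinity_conv_norm_at_top norm_swap)
  have K: "prod.swap z \<in> K_plus h'" if "z \<in> K_minus h" for z
    using that unfolding K_minus_def K_plus_def bounded_set_def mem_Collect_eq bounded_iff
    by (simp add: iter)
  show ?thesis
  proof (rule exI[of _ Gp], rule exI[of _ Gm], intro conjI allI)
    show "(\<lambda>k. G_minus h k z) \<longlonglongrightarrow> Gm z" for z
      unfolding G_minus Gm_def by (rule G'(1))
    show cont: "continuous_on UNIV Gm"
      unfolding Gm_def by (rule continuous_on_compose2[OF G'(2)]) (auto intro!: continuous_intros)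
    show "plurisubharmonic_on UNIV (\<lambda>z. ereal (Gp z))"
      by (rule plurisubharmonic_onI_continuous[OF Gp(2-4)])
    show "plurisubharmonic_on UNIV (\<lambda>z. ereal (Gm z))"
    proof (rule plurisubharmonic_onI_continuous[OF cont])
      show "2 * pi * Gm a \<le> integral {0..2*pi} (\<lambda>t. Gm (complex_line a b (cis t)))" for a b
        using G'(4)[of "prod.swap a" "prod.swap b"] by (simp add: Gm_def complex_line_def)
    qed (simp add: Gm_def G'(3))
    show "pluriharmonic_on (U_plus h) Gp"
      by (rule locally_Re_holo_imp_pluriharmonic_on[OF Gp(5)])
    show "pluriharmonic_on (interior (K_plus h)) Gp"
      by (rule pluriharmonic_on_zero[OF open_interior Gp(6)]) (rule subsetD[OF interior_subset])
    show "pluriharmonic_on (U_minus h) Gm"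
      unfolding U Gm_def by (rule locally_Re_holo_imp_pluriharmonic_on[OF locally_Re_holo_swap[OF G'(5)]])
    show "pluriharmonic_on (interior (K_minus h)) Gm"
      unfolding Gm_def
      by (rule pluriharmonic_on_zero[OF open_interior G'(6)[OF K]]) (rule subsetD[OF interior_subset])
  qed (rule Gp)+
qed

end
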